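(* Let $q$ be a prime power, $n\ge2$, and let $R=\mathbb{F}_q[x_1,\dots,x_n]/I$ be an $(n-1,m)$-Hom-Furstenberg algebra with $m\ge (e^2n)^n$. Then $$\dim_{\mathbb{F}_q}R\ge F(n,m,q)\,m^{n/(n-1)},\qquad F(n,m,q)=\left(e\Big(1+\frac{m^{1/(n-1)}}{eq}\Big)^{1/(n-1)}+\frac{m^{1/(n-1)}}{q}\right)^{-1}.$$
   Context: For an ideal $I\subseteq\mathbb{F}_q[x_1,\dots,x_n]$, $R=\mathbb{F}_q[x_1,\dots,x_n]/I$; $\dim_{\mathbb{F}_q}R$ is its vector space dimension, assumed finite. $R$ (with $I$ homogeneous) is $(k,m)$-Hom-Furstenberg if for every $k$-dimensional linear subspace $V\subseteq\mathbb{F}_q^n$, $\dim_{\mathbb{F}_q}\mathbb{F}_q[x]/(I+\mathbf{I}(V))\ge m$, where $\mathbf{I}(V)$ is the ideal of polynomials vanishing on $V$. *)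

theory Defs
  imports
    Complex_Main
    "HOL-Library.Poly_Mapping"
    "HOL-Analysis.Cartesian_Space"
    "HOL-Algebra.QuotRing"
    "HOL-Algebra.Embedded_Algebras"
    "HOL-Algebra.Algebraic_Closure_Type"
begin

text \<open>
  A polynomial in the variables indexed by \<open>'n\<close> is a finitely supported map from exponent
  vectors to coefficients; its ring operations are the convolution instances of \<open>poly_mapping\<close>.
\<close>

type_synonym ('n, 'a) mpoly = "('n \<Rightarrow>\<^sub>0 nat) \<Rightarrow>\<^sub>0 'a"

abbreviation mpoly_ring :: "('n, 'a::field) mpoly ring"
  where "mpoly_ring \<equiv> ring_of_type_algebra"

definition mpoly_const :: "'a::field \<Rightarrow> ('n, 'a) mpoly"
  where "mpoly_const c = Poly_Mapping.single 0 c"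

definition total_deg :: "('n::finite \<Rightarrow>\<^sub>0 nat) \<Rightarrow> nat"
  where "total_deg t = (\<Sum>i\<in>UNIV. Poly_Mapping.lookup t i)"

definition hom_component :: "nat \<Rightarrow> ('n::finite, 'a::field) mpoly \<Rightarrow> ('n, 'a) mpoly"
  where "hom_component d f =
    (\<Sum>t | t \<in> Poly_Mapping.keys f \<and> total_deg t = d. Poly_Mapping.single t (Poly_Mapping.lookup f t))"

definition homogeneous_ideal :: "('n::finite, 'a::field) mpoly set \<Rightarrow> bool"
  where "homogeneous_ideal I \<longleftrightarrow>
    ideal I mpoly_ring \<and> (\<forall>f\<in>I. \<forall>d. hom_component d f \<in> I)"

text \<open>Evaluation at a point over an extension field, coefficients being mapped by \<open>h\<close>.\<close>

definition mpoly_eval ::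
  "('a::field \<Rightarrow> 'b::field) \<Rightarrow> ('n::finite, 'a) mpoly \<Rightarrow> 'b ^ 'n \<Rightarrow> 'b"
  where "mpoly_eval h f p =
    (\<Sum>t\<in>Poly_Mapping.keys f. h (Poly_Mapping.lookup f t) * (\<Prod>i\<in>UNIV. (p $ i) ^ Poly_Mapping.lookup t i))"

text \<open>
  The linear variety cut out by a subspace \<open>V\<close> of \<open>F^n\<close>: its points over the algebraic closure
  of \<open>F\<close>.
\<close>

definition geometric_points :: "('a::field ^ 'n::finite) set \<Rightarrow> ('a alg_closure ^ 'n) set"
  where "geometric_points V = vec.span ((\<lambda>v. \<chi> i. to_ac (v $ i)) ` V)"

text \<open>
  The ideal \<open>I(V)\<close> of polynomials over \<open>F\<close> vanishing on the linear variety \<open>V\<close>. The vanishing is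
  required at all geometric points. For finite \<open>F\<close>, vanishing at the \<open>F\<close>-rational points alone
  would put every \<open>x_i^q - x_i\<close> into the ideal; the quotient by its sum with a homogeneous ideal of
  finite codimension would then have dimension at most 1 for every \<open>V\<close>.
\<close>

definition vanishing_ideal :: "('a::field ^ 'n::finite) set \<Rightarrow> ('n, 'a) mpoly set"
  where "vanishing_ideal V = {f. \<forall>p \<in> geometric_points V. mpoly_eval to_ac f p = 0}"

lemma vanishing_ideal_rational_points:
  assumes "f \<in> vanishing_ideal V" and "v \<in> V"
  shows "mpoly_eval (\<lambda>c. c) f v = 0"
proof -
  have "(\<chi> i. to_ac (v $ i)) \<in> geometric_points V"
    unfolding geometric_points_def using assms(2) by (intro vec.span_base) auto
  hence "mpoly_eval to_ac f (\<chi> i. to_ac (v $ i)) = 0"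
    using assms(1) by (simp add: vanishing_ideal_def)
  moreover have "mpoly_eval to_ac f (\<chi> i. to_ac (v $ i)) = to_ac (mpoly_eval (\<lambda>c. c) f v)"
    by (simp add: mpoly_eval_def to_ac_sum to_ac_prod)
  ultimately show ?thesis by simp
qed

text \<open>
  The scalars of the quotient algebra by \<open>I\<close> are the residue classes of the constants.
\<close>

definition quot_scalars :: "('n, 'a::field) mpoly set \<Rightarrow> ('n, 'a) mpoly set set"
  where "quot_scalars I = range (\<lambda>c. I +>\<^bsub>mpoly_ring\<^esub> mpoly_const c)"

definition quot_finite_dim :: "('n, 'a::field) mpoly set \<Rightarrow> bool"
  where "quot_finite_dim I \<longleftrightarrow>
    ring.finite_dimension (mpoly_ring Quot I) (quot_scalars I) (carrier (mpoly_ring Quot I))"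

definition quot_dim :: "('n, 'a::field) mpoly set \<Rightarrow> nat"
  where "quot_dim I =
    ring.dim (mpoly_ring Quot I) (quot_scalars I) (carrier (mpoly_ring Quot I))"

text \<open>
  \<open>hom_furstenberg k m I\<close> concerns the quotient by \<open>I\<close>, and is meant for \<open>I\<close> of finite codimension
  (\<open>quot_dim\<close> is unspecified otherwise).
\<close>

definition hom_furstenberg :: "nat \<Rightarrow> nat \<Rightarrow> ('n::finite, 'a::field) mpoly set \<Rightarrow> bool"
  where "hom_furstenberg k m I \<longleftrightarrow>
    homogeneous_ideal I \<and>
    (\<forall>V :: ('a ^ 'n) set. vec.subspace V \<and> vec.dim V = k \<longrightarrow>
       m \<le> quot_dim (I <+>\<^bsub>mpoly_ring\<^esub> vanishing_ideal V))"

definition furstenberg_factor :: "nat \<Rightarrow> nat \<Rightarrow> nat \<Rightarrow> real"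
  where "furstenberg_factor n m q =
    inverse (exp 1 * (1 + real m powr (1 / (real n - 1)) / (exp 1 * real q)) powr (1 / (real n - 1))
             + real m powr (1 / (real n - 1)) / real q)"

end

theory Submission
  imports Defs "HOL-Library.Function_Algebras" "HOL-Analysis.Convex" "Jordan_Normal_Form.Determinant"
begin

text \<open>
  Let \<open>N\<close> be the dimension of the quotient algebra, let \<open>L\<close> be the algebraic closure of the ground
  field with \<open>q\<close> elements, and let \<open>m'\<close> be the dimension of the section by a generic linear form over
  \<open>L\<close>. A maximal minor of multiplication by the generic form is a nonzero polynomial of degree
  \<open>N - m'\<close> in the coefficients of the form. It vanishes to order at least \<open>m - m'\<close> at every
  rational point, so the Schwartz-Zippel lemma with multiplicities gives \<open>q (m - m') \<le> N - m'\<close>.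
  On the other hand, for generic forms \<open>h1\<close> and \<open>h2\<close> the section of the ideal \<open>I : h1\<close> by \<open>h2\<close> has
  dimension at least that of \<open>I + (h2)\<close> minus that of \<open>I + (h1, h2)\<close>, and the codimension of \<open>I\<close>
  is the sum of those of \<open>I + (h1)\<close> and \<open>I : h1\<close>. By induction on the codimension and the number of
  variables, \<open>m' \<le> (e N) powr ((n - 1) / n)\<close>. Together \<open>m \<le> (e N) powr ((n - 1) / n) + N / q\<close>, which
  implies the bound on \<open>N\<close>.
\<close>

section \<open>Finite-dimensional subspaces\<close>

text \<open>Over the ground field there may be no generic form, since a nonzero polynomial in the
  coefficients can vanish at every rational point. Over \<open>L\<close> there is one, but the
  hypothesis is silent about it, as it speaks of rational hyperplanes only. The minor bridges the
  gap because it sees both: the generic rank in its degree, the rational ranks in its multiplicities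
  on a finite grid.

  The induction has to pass from I to I + (h) and I : h for forms h that are not rational. To avoid
  ideals over \<open>L\<close>, the quotients are replaced by their duals. These are
  finite-dimensional subspaces of one space of \<open>L\<close>-valued functionals on the
  polynomials over the ground field, stable under commuting operators, one for each variable. What
  the induction retains of the polynomial ring is that the functionals killed by all variables form
  a space of dimension at most 1.\<close>

locale lin_space = vector_space scale
  for scale :: "'a::field \<Rightarrow> 'b::ab_group_add \<Rightarrow> 'b"
begin

text \<open>The ambient spaces of functionals are infinite-dimensional, so finiteness is attached to
  the subspace.\<close>

definition fin_dim :: "'b set \<Rightarrow> bool"
  where "fin_dim U \<longleftrightarrow> subspace U \<and> (\<exists>B. finite B \<and> U \<subseteq> span B)"

lemma fin_dim_subspace: "fin_dim U \<Longrightarrow> subspace U"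
  by (simp add: fin_dim_def)

lemma fin_dim_subset: "fin_dim W \<Longrightarrow> subspace U \<Longrightarrow> U \<subseteq> W \<Longrightarrow> fin_dim U"
  by (auto simp: fin_dim_def)

lemma independent_le_dim:
  assumes "fin_dim W" "independent S" "S \<subseteq> W"
  shows "finite S" "card S \<le> dim W"
proof -
  obtain B where B: "finite B" "W \<subseteq> span B" using assms(1) by (auto simp: fin_dim_def)
  show "finite S" using independent_span_bound[OF B(1) assms(2)] B(2) assms(3) by blast
  obtain C where C: "C \<subseteq> W" "independent C" "W \<subseteq> span C" "card C = dim W"
    using basis_exists by blast
  have "finite C" using independent_span_bound[OF B(1) C(2)] B(2) C(1) by blast
  thus "card S \<le> dim W"
    using independent_span_bound[OF _ assms(2), of C] C assms(3) by auto
qed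

lemma fin_dim_basis:
  assumes "fin_dim U"
  obtains B where "finite B" "independent B" "B \<subseteq> U" "span B = U" "card B = dim U"
proof -
  obtain C where C: "C \<subseteq> U" "independent C" "U \<subseteq> span C" "card C = dim U"
    using basis_exists by blast
  show ?thesis
    by (rule that[of C]) (use C independent_le_dim[OF assms C(2,1)] span_subspace fin_dim_subspace[OF assms] in auto)
qed

lemma dim_le:
  assumes "fin_dim W" "U \<subseteq> W"
  shows "dim U \<le> dim W"
  by (metis assms basis_exists independent_le_dim(2) subset_trans)

text \<open>Coordinates for a basis of the whole space extending \<open>B\<close>. Being defined
  everywhere, they can later be applied to images under perturbed operators.\<close>

lemma dual_functional_exists:
  assumes "independent B"
  shows "\<exists>\<phi>. (\<forall>b. Vector_Spaces.linear scale (*) (\<phi> b)) \<and>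
    (\<forall>b\<in>B. \<forall>c\<in>B. \<phi> b c = (if b = c then 1 else 0))"
proof (intro exI[of _ "\<lambda>b v. representation (extend_basis B) v b"] conjI allI ballI)
  let ?E = "extend_basis B"
  have E: "independent ?E" "span ?E = UNIV"
    using independent_extend_basis[OF assms] span_extend_basis[OF assms] by auto
  show "Vector_Spaces.linear scale (*) (\<lambda>v. representation ?E v b)" for b
    using linear_representation[OF E] .
  fix b c assume "b \<in> B" "c \<in> B"
  thus "representation ?E c b = (if b = c then 1 else 0)"
    using representation_basis[OF E(1), of c] extend_basis_superset[OF assms] by auto
qed

lemma linear_endoI:
  assumes "\<And>x y. f (x + y) = f x + f y" "\<And>c x. f (scale c x) = scale c (f x)"
  shows "Vector_Spaces.linear scale scale f"
  using assms vector_space_axioms by (auto simp: Vector_Spaces.linear_iff)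

end

locale lin_space_pair = vs1: lin_space s1 + vs2: lin_space s2
  for s1 :: "'a::field \<Rightarrow> 'b::ab_group_add \<Rightarrow> 'b"
  and s2 :: "'a::field \<Rightarrow> 'c::ab_group_add \<Rightarrow> 'c"
begin

sublocale vector_space_pair s1 s2 ..

lemma rank_nullity:
  assumes f: "Vector_Spaces.linear s1 s2 f" and U: "vs1.fin_dim U"
  shows "vs2.fin_dim (f ` U)"
    and "vs1.dim U = vs2.dim (f ` U) + vs1.dim {u \<in> U. f u = 0}"
proof -
  let ?K = "{u \<in> U. f u = 0}"
  have sU: "vs1.subspace U" using U vs1.fin_dim_subspace by blast
  have "?K = U \<inter> {u. f u = 0}" by auto
  hence sK: "vs1.subspace ?K"
    using vs1.subspace_inter[OF sU linear_subspace_kernel[OF f]] by simp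
  obtain A where A: "finite A" "vs1.independent A" "A \<subseteq> ?K" "vs1.span A = ?K" "card A = vs1.dim ?K"
    using vs1.fin_dim_basis[OF vs1.fin_dim_subset[OF U sK]] by blast
  obtain B where B: "A \<subseteq> B" "B \<subseteq> U" "vs1.independent B" "U \<subseteq> vs1.span B"
    using vs1.maximal_independent_subset_extend[of A U] A by auto
  have sB: "vs1.span B = U" using B vs1.span_subspace sU by blast
  have finB: "finite B" using vs1.independent_le_dim[OF U B(3,2)] by simp
  have dU: "vs1.dim U = card B" using vs1.basis_card_eq_dim[OF B(2,4,3)] by simp
  define C where "C = B - A"
  have indC: "vs1.independent C" using B(3) vs1.independent_mono C_def by blast
  \<comment> \<open>A kernel vector in the span of \<open>C\<close> also lies in the span of
    \<open>A\<close>, so its coordinates with respect to \<open>B\<close> are supported on two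
    disjoint sets.\<close>
  have inj: "inj_on f (vs1.span C)"
    unfolding linear_inj_on_iff_eq_0[OF f vs1.subspace_span]
  proof (intro ballI impI)
    fix x assume x: "x \<in> vs1.span C" "f x = 0"
    have "x \<in> U" using x(1) vs1.span_mono[of C B] sB C_def by auto
    hence xA: "x \<in> vs1.span A" using x A by auto
    show "x = 0"
    proof (rule ccontr)
      assume nz: "x \<noteq> 0"
      have iB: "vs1.representation B x = vs1.representation C x"
        using vs1.representation_extend[OF B(3) x(1)] C_def by auto
      have iA: "vs1.representation B x = vs1.representation A x"
        using vs1.representation_extend[OF B(3) xA] B(1) by auto
      have "vs1.representation B x b = 0" for b
        using iA iB vs1.representation_ne_zero[of A x b] vs1.representation_ne_zero[of C x b] C_def
        by (metis Diff_iff)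
      thus False
        using vs1.sum_nonzero_representation_eq[OF B(3), of x] \<open>x \<in> U\<close> sB nz by simp
    qed
  qed
  have indf: "vs2.independent (f ` C)"
    using linear_independent_injective_image[OF f indC inj] .
  have "f ` A \<subseteq> {0}" using A(3) by auto
  hence "f ` B \<subseteq> insert 0 (f ` C)" by (auto simp: C_def)
  hence "vs2.span (f ` B) \<subseteq> vs2.span (f ` C)"
    using vs2.span_mono vs2.span_insert_0 by blast
  moreover have "vs2.span (f ` C) \<subseteq> vs2.span (f ` B)"
    by (intro vs2.span_mono) (auto simp: C_def)
  ultimately have "vs2.span (f ` B) = vs2.span (f ` C)" by blast
  hence im: "f ` U = vs2.span (f ` C)"
    using linear_span_image[OF f, of B] sB by simp
  have finC: "finite (f ` C)" using finB C_def by simp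
  show "vs2.fin_dim (f ` U)" using im finC vs2.fin_dim_def by auto
  have "vs2.dim (f ` U) = card (f ` C)"
    unfolding im using vs2.dim_span_eq_card_independent[OF indf] .
  also have "\<dots> = card C"
    using inj vs1.span_superset inj_on_subset card_image by metis
  also have "\<dots> = card B - card A" using C_def A(1) B(1) by (simp add: card_Diff_subset)
  finally show "vs1.dim U = vs2.dim (f ` U) + vs1.dim ?K"
    using dU A(5) card_mono[OF finB B(1)] by simp
qed

end

section \<open>Real inequalities\<close>

text \<open>Young's inequality for \<open>x powr p\<close> and \<open>1\<close> with weights
  \<open>1 / p\<close> and \<open>1 - 1 / p\<close>, solved for \<open>x powr p\<close>.\<close>

lemma Bernoulli_inequality_powr:
  fixes x p :: real
  assumes "x \<ge> 0" "p \<ge> 1"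
  shows "1 + p * (x - 1) \<le> x powr p"
proof (cases "x = 0")
  case False
  define c where "c = 1 / p"
  have c: "0 < c" "c \<le> 1" using assms by (auto simp: c_def)
  have "(x powr p) powr c * 1 powr (1 - c) \<le> c * x powr p + (1 - c) * 1"
    using c assms False Youngs_inequality_0[of c "1 - c" "x powr p" 1] by simp
  moreover have "(x powr p) powr c = x" using assms False by (simp add: powr_powr c_def)
  ultimately have "x \<le> c * x powr p + (1 - c)" by simp
  hence "p * x \<le> p * (c * x powr p + (1 - c))" using assms by (intro mult_left_mono) auto
  also have "\<dots> = x powr p + p - 1" using assms by (simp add: c_def field_simps)
  finally show ?thesis by (simp add: algebra_simps)
qed (use assms in auto)

text \<open>
  The constant \<open>e\<close> propagates from \<open>k\<close> to \<open>k + 1\<close> because of \<open>1 + 1/(k+1) \<le> exp (1/(k+1))\<close>.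
\<close>

lemma section_bound_step:
  fixes c c' D D1 :: real and k :: nat
  assumes nn: "c \<ge> 0" "c' \<ge> 0" "D1 \<ge> 0" "D1 + c \<le> D"
    and sub: "c - c' \<le> (exp 1 * D1) powr (real (Suc k) / real (Suc (Suc k)))"
    and sec: "c' \<le> (exp 1 * c) powr (real k / real (Suc k))"
  shows "c \<le> (exp 1 * D) powr (real (Suc k) / real (Suc (Suc k)))"
proof (cases "c = 0")
  case False
  hence c: "c > 0" using nn by simp
  \<comment> \<open>Here \<open>c\<close> and \<open>c'\<close> stand for the codimensions of
    sections by one and by two forms, \<open>D1\<close> and \<open>D\<close> for those of a colon
    ideal and of the ideal itself. As \<open>p\<close> is the reciprocal of the exponent, the claim
    reads \<open>c powr p \<le> exp 1 * D\<close>.\<close>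
  define p where "p = 1 + 1 / real (Suc k)"
  have p: "p \<ge> 1" "p > 0" and p_eq: "p = real (Suc (Suc k)) / real (Suc k)"
    by (auto simp: p_def field_simps)
  have pinv: "real (Suc k) / real (Suc (Suc k)) * p = 1" by (simp add: p_eq del: of_nat_Suc)
  \<comment> \<open>Bernoulli at \<open>(c - c') / c\<close> makes the estimate linear in
    \<open>c'\<close>, so that the hypothesis on \<open>c'\<close> can be inserted
    afterwards.\<close>
  have main: "c powr p * (1 - p * (c' / c)) \<le> exp 1 * D1"
  proof (cases "c' \<le> c")
    case True
    have "c powr p * (1 - p * (c' / c)) = c powr p * (1 + p * ((c - c') / c - 1))"
      using c by (simp add: field_simps)
    also have "\<dots> \<le> c powr p * ((c - c') / c) powr p"
      using c True p by (intro mult_left_mono Bernoulli_inequality_powr) auto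
    also have "\<dots> = (c - c') powr p"
      using c True by (simp add: powr_divide)
    also have "\<dots> \<le> ((exp 1 * D1) powr (real (Suc k) / real (Suc (Suc k)))) powr p"
      using sub True p by (intro powr_mono2) auto
    also have "\<dots> = exp 1 * D1"
      unfolding powr_powr pinv using nn by simp
    finally show ?thesis .
  next
    case False
    have "1 \<le> c' / c" using False c by simp
    hence "1 * 1 \<le> p * (c' / c)" using p by (intro mult_mono) auto
    hence "c powr p * (1 - p * (c' / c)) \<le> 0" by (intro mult_nonneg_nonpos) auto
    also have "0 \<le> exp 1 * D1" using nn by simp
    finally show ?thesis .
  qed
  have pc: "c powr p = c * c powr (1 / real (Suc k))"
    using c by (simp add: p_def powr_add)
  have "c powr p * (p * (c' / c)) = p * (c' * c powr (1 / real (Suc k)))"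
    using c by (simp add: pc del: of_nat_Suc)
  also have "\<dots> \<le> p * ((exp 1 * c) powr (real k / real (Suc k)) * c powr (1 / real (Suc k)))"
    using p sec by (intro mult_left_mono mult_right_mono) auto
  also have "\<dots> = p * (exp (real k / real (Suc k)) * c)"
  proof -
    have "(exp 1 * c) powr (real k / real (Suc k)) * c powr (1 / real (Suc k))
        = exp 1 powr (real k / real (Suc k)) * c powr (real k / real (Suc k) + 1 / real (Suc k))"
      using c by (simp add: powr_mult powr_add del: of_nat_Suc)
    also have "real k / real (Suc k) + 1 / real (Suc k) = 1" by (simp add: field_simps)
    finally show ?thesis using c by (simp add: powr_def del: of_nat_Suc)
  qed
  also have "\<dots> \<le> exp (1 / real (Suc k)) * (exp (real k / real (Suc k)) * c)"
    unfolding p_def using c by (intro mult_right_mono exp_ge_add_one_self) auto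
  also have "\<dots> = exp (1 / real (Suc k) + real k / real (Suc k)) * c"
    by (simp add: exp_add del: of_nat_Suc)
  also have "1 / real (Suc k) + real k / real (Suc k) = 1" by (simp add: field_simps)
  finally have "c powr p * (p * (c' / c)) \<le> exp 1 * c" .
  with main have "c powr p \<le> exp 1 * (D1 + c)" by (simp add: algebra_simps)
  also have "\<dots> \<le> exp 1 * D" using nn by simp
  finally have "(c powr p) powr (real (Suc k) / real (Suc (Suc k)))
      \<le> (exp 1 * D) powr (real (Suc k) / real (Suc (Suc k)))"
    by (intro powr_mono2) auto
  thus ?thesis unfolding powr_powr mult.commute[of p] pinv using c by simp
qed (use nn in auto)

text \<open>This is where the shape of the factor comes from. With \<open>y\<close> and
  \<open>z\<close> as below and \<open>N = m * y / (exp 1 * x)\<close>, equality in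
  \<open>bound\<close> becomes \<open>x = x powr (1 / n) + z\<close>, an equation without a
  convenient closed solution. The explicit \<open>G\<close> is an upper estimate of the solution:
  \<open>G \<le> (1 + z) powr (1 + r)\<close> gives
  \<open>G powr (1 / n) \<le> (1 + z) powr r\<close>, hence
  \<open>G \<ge> G powr (1 / n) + z\<close>.\<close>

lemma furstenberg_numeric:
  fixes N m :: real and q n :: nat
  assumes n: "n \<ge> 2" and q: "q > 0" and m: "m > 0" and N: "N \<ge> 0"
    and bound: "m \<le> (exp 1 * N) powr ((real n - 1) / real n) + N / real q"
  shows "N \<ge> inverse (exp 1 * (1 + m powr (1 / (real n - 1)) / (exp 1 * real q)) powr (1 / (real n - 1))
             + m powr (1 / (real n - 1)) / real q) * m powr (real n / (real n - 1))"
proof -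
  define r where "r = 1 / (real n - 1)"
  have n1: "real n - 1 > 0" using n by simp
  have r: "r > 0" using n1 by (simp add: r_def)
  define y where "y = m powr r"
  have y: "y > 0" using m by (simp add: y_def)
  define z where "z = y / (exp 1 * real q)"
  have z: "z > 0" using y q by (simp add: z_def)
  define G where "G = (1 + z) powr r + z"
  have G: "G > 0" using z by (simp add: G_def add_nonneg_pos)
  have E: "exp 1 * (1 + m powr r / (exp 1 * real q)) powr r + m powr r / real q = exp 1 * G"
    unfolding G_def distrib_left by (simp add: z_def y_def)
  have nr: "real n / (real n - 1) = 1 + r" using n1 by (simp add: r_def field_simps)
  have pm: "m powr (1 + r) = m * y" using m by (simp add: powr_add y_def)
  have "m * y / (exp 1 * G) \<le> N"
  proof (rule ccontr)
    assume "\<not> ?thesis"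
    hence less: "N < m * y / (exp 1 * G)" by simp
    define s where "s = (real n - 1) / real n"
    have s: "s > 0" "(1 + r) * s = 1" using n n1 by (auto simp: s_def r_def field_simps)
    have "(exp 1 * N) powr s \<le> (m * y / G) powr s"
      using less N s G by (intro powr_mono2) (auto simp: field_simps)
    also have "\<dots> = m / G powr s"
      unfolding pm[symmetric] using m G s(2) by (simp add: powr_divide powr_powr)
    also have "\<dots> \<le> m * (1 + z) powr r / G"
    proof -
      have "G \<le> (1 + z) powr r + z * (1 + z) powr r"
        unfolding G_def using z r by (simp add: ge_one_powr_ge_zero)
      also have "\<dots> = (1 + z) powr (1 + r)" using z by (simp add: powr_add algebra_simps)
      finally have "G powr (1 - s) \<le> ((1 + z) powr (1 + r)) powr (1 - s)"
        using G n by (intro powr_mono2) (auto simp: s_def field_simps)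
      also have "\<dots> = (1 + z) powr r"
        unfolding powr_powr using s(2) by (simp add: algebra_simps)
      finally have "G / G powr s \<le> (1 + z) powr r"
        using G by (simp add: powr_diff)
      hence "m * (G / G powr s) / G \<le> m * (1 + z) powr r / G"
        using m G by (intro divide_right_mono mult_left_mono) auto
      thus ?thesis using G by simp
    qed
    finally have 1: "(exp 1 * N) powr s \<le> m * (1 + z) powr r / G" .
    have "N / real q < m * y / (exp 1 * G) / real q"
      using less q by (intro divide_strict_right_mono) auto
    also have "\<dots> = m * z / G" by (simp add: z_def)
    finally have "(exp 1 * N) powr s + N / real q < m * (1 + z) powr r / G + m * z / G"
      using 1 by simp
    also have "\<dots> = m * G / G" by (simp add: G_def add_divide_distrib[symmetric] distrib_left)
    also have "\<dots> = m" using G by simp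
    finally show False using bound by (simp add: s_def)
  qed
  thus ?thesis
    unfolding r_def[symmetric] E nr pm by (simp add: field_simps)
qed

section \<open>The Schwartz-Zippel lemma with multiplicities\<close>

text \<open>
  Polynomial functions of total degree at most \<open>d\<close>, expanded in one variable at a time so that the
  leading coefficient in the first variable is accessible.
\<close>

primrec polyfun :: "'i list \<Rightarrow> nat \<Rightarrow> (('i \<Rightarrow> 'a::field) \<Rightarrow> 'a) \<Rightarrow> bool" where
  "polyfun [] d f \<longleftrightarrow> (\<exists>c. f = (\<lambda>_. c))"
| "polyfun (i # xs) d f \<longleftrightarrow>
     (\<exists>g. (\<forall>j. polyfun xs (d - j) (g j)) \<and> (\<forall>j>d. g j = (\<lambda>_. 0)) \<and>
          f = (\<lambda>t. \<Sum>j\<le>d. g j t * t i ^ j))"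

lemma polyfun_const: "polyfun xs d (\<lambda>_. c)"
proof (induction xs arbitrary: d c)
  case (Cons i xs)
  have "(\<lambda>t. c) = (\<lambda>t::'a\<Rightarrow>'b. \<Sum>j\<le>d. (if j = 0 then c else 0) * t i ^ j)"
    by (simp add: if_distrib[of "\<lambda>x. x * _"] cong: if_cong)
  thus ?case using Cons by (auto intro!: exI[of _ "\<lambda>j _. if j = 0 then c else 0"])
qed auto

lemma polyfun_add:
  "polyfun xs d f \<Longrightarrow> polyfun xs d f' \<Longrightarrow> polyfun xs d (\<lambda>t. f t + f' t)"
proof (induction xs arbitrary: d f f')
  case (Cons i xs)
  obtain g where g: "\<And>j. polyfun xs (d - j) (g j)" "\<And>j. j > d \<Longrightarrow> g j = (\<lambda>_. 0)"
    "f = (\<lambda>t. \<Sum>j\<le>d. g j t * t i ^ j)" using Cons.prems(1) unfolding polyfun.simps by blast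
  obtain g' where g': "\<And>j. polyfun xs (d - j) (g' j)" "\<And>j. j > d \<Longrightarrow> g' j = (\<lambda>_. 0)"
    "f' = (\<lambda>t. \<Sum>j\<le>d. g' j t * t i ^ j)" using Cons.prems(2) unfolding polyfun.simps by blast
  show ?case unfolding polyfun.simps
  proof (intro exI[of _ "\<lambda>j t. g j t + g' j t"] conjI allI impI)
    show "polyfun xs (d - j) (\<lambda>t. g j t + g' j t)" for j by (rule Cons.IH[OF g(1) g'(1)])
    show "(\<lambda>t. g j t + g' j t) = (\<lambda>_. 0)" if "j > d" for j
      by (simp add: g(2)[OF that] g'(2)[OF that])
    show "(\<lambda>t. f t + f' t) = (\<lambda>t. \<Sum>j\<le>d. (g j t + g' j t) * t i ^ j)"
      by (simp add: g(3) g'(3) sum.distrib distrib_right)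
  qed
qed auto

lemma polyfun_sum:
  "(\<And>x. x \<in> A \<Longrightarrow> polyfun xs d (f x)) \<Longrightarrow> polyfun xs d (\<lambda>t. \<Sum>x\<in>A. f x t)"
proof (induction A rule: infinite_finite_induct)
  case (insert x A)
  have "polyfun xs d (\<lambda>t. f x t + (\<Sum>x\<in>A. f x t))"
    by (rule polyfun_add) (use insert in auto)
  thus ?case using insert.hyps by simp
qed (simp_all add: polyfun_const)

lemma polyfun_mult:
  "polyfun xs d f \<Longrightarrow> polyfun xs d' f' \<Longrightarrow> polyfun xs (d + d') (\<lambda>t. f t * f' t)"
proof (induction xs arbitrary: d d' f f')
  case (Cons i xs)
  obtain g where g: "\<And>j. polyfun xs (d - j) (g j)" "\<And>j. j > d \<Longrightarrow> g j = (\<lambda>_. 0)"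
    "f = (\<lambda>t. \<Sum>j\<le>d. g j t * t i ^ j)" using Cons.prems(1) unfolding polyfun.simps by blast
  obtain g' where g': "\<And>j. polyfun xs (d' - j) (g' j)" "\<And>j. j > d' \<Longrightarrow> g' j = (\<lambda>_. 0)"
    "f' = (\<lambda>t. \<Sum>j\<le>d'. g' j t * t i ^ j)" using Cons.prems(2) unfolding polyfun.simps by blast
  define h where "h = (\<lambda>l t. \<Sum>j\<le>l. g j t * g' (l - j) t)"
  have "polyfun xs (d + d' - l) (h l)" for l
    unfolding h_def
  proof (rule polyfun_sum)
    fix j assume "j \<in> {..l}"
    show "polyfun xs (d + d' - l) (\<lambda>t. g j t * g' (l - j) t)"
    \<comment> \<open>Subtraction truncates at 0, so the two degree bounds add up to
      \<open>d + d' - l\<close> only in this case. Otherwise one factor is zero, by the clause of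
      \<open>polyfun\<close> for large \<open>j\<close>.\<close>
    proof (cases "j \<le> d \<and> l - j \<le> d'")
      case True
      hence "d - j + (d' - (l - j)) = d + d' - l" using \<open>j \<in> {..l}\<close> by auto
      thus ?thesis using Cons.IH[OF g(1) g'(1), of j "l - j"] by simp
    next
      case False
      hence "(\<lambda>t. g j t * g' (l - j) t) = (\<lambda>_. 0)" using g(2) g'(2) by (auto simp: not_le)
      thus ?thesis using polyfun_const by simp
    qed
  qed
  moreover have "h l = (\<lambda>_. 0)" if "l > d + d'" for l
  proof
    fix t show "h l t = 0"
      unfolding h_def
    proof (intro sum.neutral ballI)
      fix j assume "j \<in> {..l}"
      show "g j t * g' (l - j) t = 0"
      proof (cases "j > d")
        case False
        hence "l - j > d'" using that by simp
        thus ?thesis using g'(2) by simp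
      qed (use g(2) in auto)
    qed
  qed
  moreover have "(\<lambda>t. f t * f' t) = (\<lambda>t. \<Sum>l\<le>d + d'. h l t * t i ^ l)"
    unfolding g(3) g'(3) h_def using g(2) g'(2) by (intro ext polynomial_product) auto
  ultimately show ?case unfolding polyfun.simps by blast
qed auto

lemma polyfun_prod:
  assumes "finite A" "\<And>x. x \<in> A \<Longrightarrow> polyfun xs 1 (f x)"
  shows "polyfun xs (card A) (\<lambda>t. \<Prod>x\<in>A. f x t)"
  using assms
proof (induction A rule: finite_induct)
  case (insert x A)
  thus ?case using polyfun_mult[of xs 1 "f x" "card A" "\<lambda>t. \<Prod>x\<in>A. f x t"] by simp
qed (auto intro: polyfun_const)

lemma polyfun_var: "i \<in> set xs \<Longrightarrow> polyfun xs 1 (\<lambda>t. t i)"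
proof (induction xs)
  case (Cons k xs)
  show ?case
  proof (cases "i = k")
    case True
    show ?thesis unfolding polyfun.simps
      by (rule exI[of _ "\<lambda>j _. if j = 1 then 1 else 0"]) (use True in \<open>auto intro!: polyfun_const\<close>)
  next
    case False
    hence "polyfun xs 1 (\<lambda>t :: 'a \<Rightarrow> 'b. t i)" using Cons by simp
    thus ?thesis unfolding polyfun.simps
      by (intro exI[of _ "\<lambda>j. if j = 0 then (\<lambda>t. t i) else (\<lambda>_. 0)"]) (auto intro!: polyfun_const)
  qed
qed auto

text \<open>Applied to the coefficients of the powers of a variable that has been split off: they do
  not depend on that variable.\<close>

lemma polyfun_cong:
  "polyfun xs d f \<Longrightarrow> (\<And>i. i \<in> set xs \<Longrightarrow> t i = t' i) \<Longrightarrow> f t = f t'"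
proof (induction xs arbitrary: d f)
  case (Cons i xs)
  obtain g where g: "\<And>j. polyfun xs (d - j) (g j)" "f = (\<lambda>t. \<Sum>j\<le>d. g j t * t i ^ j)"
    using Cons.prems(1) unfolding polyfun.simps by blast
  have "g j t = g j t'" for j using Cons.IH[OF g(1)] Cons.prems(2) by simp
  thus ?case using Cons.prems(2) by (simp add: g(2))
qed auto

lemma polyfun_line:
  "polyfun xs d f \<Longrightarrow> \<exists>p. \<forall>s. f (\<lambda>i. a i + s * b i) = poly p s"
proof (induction xs arbitrary: d f)
  case Nil
  then obtain c where "f = (\<lambda>_. c)" by auto
  thus ?case by (intro exI[of _ "[:c:]"]) simp
next
  case (Cons i xs)
  obtain g where g: "\<And>j. polyfun xs (d - j) (g j)" "f = (\<lambda>t. \<Sum>j\<le>d. g j t * t i ^ j)"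
    using Cons.prems(1) unfolding polyfun.simps by blast
  have "\<forall>j. \<exists>p. \<forall>s. g j (\<lambda>i. a i + s * b i) = poly p s" using Cons.IH[OF g(1)] by blast
  from choice[OF this] obtain p where p: "\<And>j s. g j (\<lambda>i. a i + s * b i) = poly (p j) s" by blast
  show ?case
    by (rule exI[of _ "\<Sum>j\<le>d. p j * [:a i, b i:] ^ j"]) (simp add: g(2) p poly_sum)
qed

text \<open>Over an infinite field the order of vanishing along all lines is the multiplicity.\<close>

definition vanishes_to_order :: "(('i \<Rightarrow> 'a::field) \<Rightarrow> 'a) \<Rightarrow> ('i \<Rightarrow> 'a) \<Rightarrow> nat \<Rightarrow> bool"
  where "vanishes_to_order f a M \<longleftrightarrow> (\<forall>b. \<exists>p. \<forall>s. f (\<lambda>i. a i + s * b i) = s ^ M * poly p s)"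

lemma poly_eq_infinite:
  fixes p r :: "'a::field poly"
  assumes "infinite (UNIV :: 'a set)" "\<And>s. poly p s = poly r s"
  shows "p = r"
proof (rule ccontr)
  assume "p \<noteq> r"
  hence "finite {s. poly (p - r) s = 0}" by (intro poly_roots_finite) simp
  thus False using assms by simp
qed

lemma pcompose_power: "pcompose (p ^ n) r = pcompose p r ^ n"
  by (induction n) (auto simp: pcompose_mult pcompose_1)

lemma coeff_linear_power_scale:
  fixes \<alpha> \<beta> :: "'a::field"
  shows "coeff ([:\<alpha>, \<beta>:] ^ j) e = \<beta> ^ e * coeff ([:\<alpha>, 1:] ^ j) e"
proof (cases "e \<le> j")
  case True thus ?thesis by (simp add: coeff_linear_poly_power)
next
  case False
  have "degree ([:\<alpha>, \<gamma>:] ^ j) \<le> j" for \<gamma>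
    using degree_power_le[of "[:\<alpha>, \<gamma>:]" j] by (auto split: if_splits)
  hence "coeff ([:\<alpha>, \<gamma>:] ^ j) e = 0" for \<gamma> using False by (intro coeff_eq_0) (meson le_less_trans not_le)
  thus ?thesis by simp
qed

text \<open>
  The coefficient of \<open>s ^ M'\<close> in \<open>\<Sum>j\<le>J. G j (s) x ^ j\<close>, as a polynomial in \<open>x\<close>, inherits a zero of
  order \<open>M - M'\<close> at \<open>\<alpha>\<close> from a zero of order \<open>M\<close> at \<open>(s, x) = (0, \<alpha>)\<close>.
\<close>

lemma root_order_of_coefficient:
  fixes G :: "nat \<Rightarrow> 'a::field poly"
  assumes inf: "infinite (UNIV :: 'a set)"
    and van: "\<And>\<beta>. \<exists>r. \<forall>s. (\<Sum>j\<le>J. poly (G j) s * (\<alpha> + s * \<beta>) ^ j) = s ^ M * poly r s"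
  shows "[:-\<alpha>, 1:] ^ (M - M') dvd (\<Sum>j\<le>J. monom (coeff (G j) M') j)"
proof -
  \<comment> \<open>\<open>\<kappa> e l\<close> is the coefficient of \<open>y ^ e * s ^ l\<close>
    after the substitution of \<open>\<alpha> + y\<close> for \<open>x\<close>. Along
    \<open>y = s * \<beta>\<close> the coefficient of \<open>s ^ w\<close> is a polynomial
    \<open>P\<close> in \<open>\<beta>\<close>. For \<open>w < M\<close> it is zero at every
    \<open>\<beta>\<close>, so each of its coefficients is zero.\<close>
  define \<kappa> where "\<kappa> e l = (\<Sum>j\<le>J. coeff ([:\<alpha>, 1:] ^ j) e * coeff (G j) l)" for e l
  have \<kappa>0: "\<kappa> e (w - e) = 0" if "e \<le> w" "w < M" for e w
  proof -
    define P where "P = (\<Sum>e\<le>w. monom (\<kappa> e (w - e)) e)"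
    have "poly P \<beta> = poly 0 \<beta>" for \<beta>
    proof -
      obtain r where r: "\<And>s. (\<Sum>j\<le>J. poly (G j) s * (\<alpha> + s * \<beta>) ^ j) = s ^ M * poly r s"
        using van by blast
      have "(\<Sum>j\<le>J. [:\<alpha>, \<beta>:] ^ j * G j) = monom 1 M * r"
        by (rule poly_eq_infinite[OF inf]) (use r in \<open>simp add: poly_sum poly_monom mult.commute\<close>)
      hence "monom 1 M dvd (\<Sum>j\<le>J. [:\<alpha>, \<beta>:] ^ j * G j)" by simp
      hence "0 = coeff (\<Sum>j\<le>J. [:\<alpha>, \<beta>:] ^ j * G j) w"
        using that(2) by (simp add: monom_1_dvd_iff')
      also have "\<dots> = (\<Sum>j\<le>J. \<Sum>e\<le>w. coeff ([:\<alpha>, \<beta>:] ^ j) e * coeff (G j) (w - e))"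
        by (simp add: coeff_sum coeff_mult)
      also have "\<dots> = (\<Sum>e\<le>w. \<Sum>j\<le>J. coeff ([:\<alpha>, \<beta>:] ^ j) e * coeff (G j) (w - e))"
        by (rule sum.swap)
      also have "\<dots> = (\<Sum>e\<le>w. \<beta> ^ e * \<kappa> e (w - e))"
        unfolding \<kappa>_def coeff_linear_power_scale[of \<alpha> \<beta>] sum_distrib_left by (simp add: mult.assoc)
      also have "\<dots> = poly P \<beta>" by (simp add: P_def poly_sum poly_monom mult.commute)
      finally show ?thesis by simp
    qed
    hence "P = 0" by (rule poly_eq_infinite[OF inf])
    hence "coeff P e = 0" by simp
    thus ?thesis using that(1) by (simp add: P_def coeff_sum coeff_monom)
  qed
  define H where "H = (\<Sum>j\<le>J. monom (coeff (G j) M') j)"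
  have pc: "pcompose H [:\<alpha>, 1:] = (\<Sum>j\<le>J. smult (coeff (G j) M') ([:\<alpha>, 1:] ^ j))"
    unfolding H_def pcompose_sum by (simp add: monom_altdef pcompose_smult pcompose_power pcompose_pCons)
  have "coeff (pcompose H [:\<alpha>, 1:]) e = 0" if "e < M - M'" for e
    using \<kappa>0[of e "e + M'"] that unfolding pc \<kappa>_def by (simp add: coeff_sum mult.commute)
  hence "monom 1 (M - M') dvd pcompose H [:\<alpha>, 1:]" by (simp add: monom_1_dvd_iff')
  then obtain K where "pcompose H [:\<alpha>, 1:] = monom 1 (M - M') * K" by (elim dvdE)
  hence "pcompose (pcompose H [:\<alpha>, 1:]) [:-\<alpha>, 1:]
      = pcompose (monom 1 (M - M')) [:-\<alpha>, 1:] * pcompose K [:-\<alpha>, 1:]"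
    by (simp add: pcompose_mult)
  also have "pcompose (monom 1 (M - M')) [:-\<alpha>, 1:] = [:-\<alpha>, 1:] ^ (M - M')"
    by (simp add: monom_altdef pcompose_power pcompose_pCons)
  also have "pcompose (pcompose H [:\<alpha>, 1:]) [:-\<alpha>, 1:] = H"
    by (simp add: pcompose_assoc[symmetric] pcompose_pCons)
  finally show ?thesis unfolding H_def by simp
qed

text \<open>Induction on the number of variables in which degree and multiplicity are split alike.
  The leading coefficient in the first variable has degree at most \<open>d - J\<close> and vanishes
  to order \<open>M'\<close> on the grid; a one-variable polynomial \<open>H\<close> of degree at
  most \<open>J\<close> has a zero of order \<open>M - M'\<close> at each element of
  \<open>F\<close>. One order common to all grid points replaces the usual summation over
  them.\<close>

theorem multiplicity_schwartz_zippel: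
  fixes F :: "'a::field set"
  assumes inf: "infinite (UNIV :: 'a set)" and F: "finite F"
    and "distinct xs" "polyfun xs d f" "f t0 \<noteq> 0"
    and "\<And>a. (\<And>i. a i \<in> F) \<Longrightarrow> vanishes_to_order f a M"
  shows "card F * M \<le> d"
proof (cases "F = {}")
  case False
  show ?thesis using assms(3-)
  proof (induction xs arbitrary: d f t0 M)
    case Nil
    then obtain c where c: "f = (\<lambda>_. c)" "c \<noteq> 0" by auto
    obtain x where "x \<in> F" using False by blast
    then obtain p where "\<And>s. c = s ^ M * poly p s"
      using Nil.prems(4)[of "\<lambda>_. x"] c by (auto simp: vanishes_to_order_def)
    from this[of 0] have "M = 0" using c(2) by (cases M) auto
    thus ?case by simp
  next
    case (Cons i xs)
    obtain g where g: "\<And>j. polyfun xs (d - j) (g j)" "\<And>j. j > d \<Longrightarrow> g j = (\<lambda>_. 0)"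
      "f = (\<lambda>t. \<Sum>j\<le>d. g j t * t i ^ j)" using Cons.prems(2) unfolding polyfun.simps by blast
    define S where "S = {j. j \<le> d \<and> (\<exists>t. g j t \<noteq> 0)}"
    have "finite S" by (simp add: S_def)
    have "S \<noteq> {}"
    proof
      assume "S = {}"
      hence "g j t0 = 0" if "j \<le> d" for j using that by (auto simp: S_def)
      thus False using Cons.prems(3) by (simp add: g(3))
    qed
    define J where "J = Max S"
    have "J \<in> S" unfolding J_def by (rule Max_in) fact+
    then obtain t1 where J: "J \<le> d" "g J t1 \<noteq> 0" by (auto simp: S_def)
    have gJ: "g j t = 0" if "j > J" for j t
    proof (cases "j \<le> d")
      case True
      have "j \<notin> S" using that Max_ge[OF \<open>finite S\<close>, of j] by (auto simp: J_def)
      thus ?thesis using True by (auto simp: S_def)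
    qed (use g(2) in auto)
    have f: "f t = (\<Sum>j\<le>J. g j t * t i ^ j)" for t
      unfolding g(3) by (rule sum.mono_neutral_right) (use J gJ in \<open>auto simp: not_le\<close>)
    \<comment> \<open>The induction hypothesis bounds \<open>T\<close>, so there is a largest common
      order \<open>M'\<close>. The failure of \<open>Suc M'\<close> supplies a grid point
      \<open>a\<close> and a direction \<open>b\<close> along which the leading coefficient vanishes
      to order exactly \<open>M'\<close>.\<close>
    define T where "T = {M'. \<forall>a. (\<forall>i. a i \<in> F) \<longrightarrow> vanishes_to_order (g J) a M'}"
    have T: "card F * M' \<le> d - J" if "M' \<in> T" for M'
      using Cons.IH[OF _ g(1)[of J] J(2), of M'] Cons.prems(1) that by (auto simp: T_def)
    have "0 \<in> T" using polyfun_line[OF g(1)[of J]] by (auto simp: T_def vanishes_to_order_def)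
    have cF: "card F > 0" using F False by (simp add: card_gt_0_iff)
    have "M' \<le> d - J" if "M' \<in> T" for M'
      using T[OF that] cF by (metis One_nat_def Suc_leI le_trans mult_le_mono1 nat_mult_1)
    hence finT: "finite T" by (meson finite_nat_set_iff_bounded_le)
    define M' where "M' = Max T"
    have M': "M' \<in> T" unfolding M'_def using finT \<open>0 \<in> T\<close> by (intro Max_in) auto
    have "Suc M' \<notin> T" using Max_ge[OF finT, of "Suc M'"] by (auto simp: M'_def)
    then obtain a b where a: "\<And>i. a i \<in> F"
      and nb: "\<And>p. \<exists>s. g J (\<lambda>i. a i + s * b i) \<noteq> s ^ Suc M' * poly p s"
      by (auto simp: T_def vanishes_to_order_def)
    have "vanishes_to_order (g J) a M'" using M' a by (simp add: T_def)
    then obtain p where p: "\<And>s. g J (\<lambda>i. a i + s * b i) = s ^ M' * poly p s"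
      unfolding vanishes_to_order_def by blast
    have p0: "poly p 0 \<noteq> 0"
    proof
      assume "poly p 0 = 0"
      then obtain p' where "p = [:0, 1:] * p'" by (auto simp: poly_eq_0_iff_dvd elim: dvdE)
      hence "g J (\<lambda>i. a i + s * b i) = s ^ Suc M' * poly p' s" for s by (simp add: p)
      thus False using nb by blast
    qed
    have "\<forall>j. \<exists>p. \<forall>s. g j (\<lambda>i. a i + s * b i) = poly p s" using polyfun_line[OF g(1)] by blast
    from choice[OF this] obtain G where G: "\<And>j s. g j (\<lambda>i. a i + s * b i) = poly (G j) s" by blast
    have "G J = monom 1 M' * p"
      by (rule poly_eq_infinite[OF inf]) (simp add: poly_monom p flip: G)
    hence GJ: "coeff (G J) M' \<noteq> 0" using p0 by (simp add: coeff_monom_mult poly_0_coeff_0)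
    define H where "H = (\<Sum>j\<le>J. monom (coeff (G j) M') j)"
    have cH: "coeff H j = (if j \<le> J then coeff (G j) M' else 0)" for j
      by (simp add: H_def coeff_sum coeff_monom)
    have "H \<noteq> 0" using cH[of J] GJ by auto
    have degH: "degree H \<le> J" by (rule degree_le) (simp add: cH)
    have ord: "M - M' \<le> order \<alpha> H" if \<alpha>: "\<alpha> \<in> F" for \<alpha>
    proof -
      have "[:-\<alpha>, 1:] ^ (M - M') dvd H"
        unfolding H_def
      proof (rule root_order_of_coefficient[OF inf])
        fix \<beta>
        \<comment> \<open>A change in coordinate \<open>i\<close> alone leaves the
          \<open>g j\<close> as they are and lets the first variable run through
          \<open>\<alpha> + s * \<beta>\<close>.\<close>
        have "\<forall>k. (a(i := \<alpha>)) k \<in> F" using a \<alpha> by simp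
        then obtain r where r: "\<And>s. f (\<lambda>k. (a(i := \<alpha>)) k + s * (b(i := \<beta>)) k) = s ^ M * poly r s"
          using Cons.prems(4)[of "a(i := \<alpha>)"] unfolding vanishes_to_order_def by blast
        have "g j (\<lambda>k. (a(i := \<alpha>)) k + s * (b(i := \<beta>)) k) = poly (G j) s" for j s
          unfolding G[symmetric] by (rule polyfun_cong[OF g(1)]) (use Cons.prems(1) in auto)
        hence "(\<Sum>j\<le>J. poly (G j) s * (\<alpha> + s * \<beta>) ^ j) = s ^ M * poly r s" for s
          using r[of s] unfolding f by simp
        thus "\<exists>r. \<forall>s. (\<Sum>j\<le>J. poly (G j) s * (\<alpha> + s * \<beta>) ^ j) = s ^ M * poly r s" by blast
      qed
      thus ?thesis using \<open>H \<noteq> 0\<close> by (simp add: order_divides)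
    qed
    have "card F * (M - M') \<le> (\<Sum>\<alpha>\<in>F. order \<alpha> H)"
      using sum_bounded_below[of F "M - M'" "\<lambda>\<alpha>. order \<alpha> H"] ord by simp
    also have "\<dots> = (\<Sum>\<alpha>\<in>{\<alpha>\<in>F. poly H \<alpha> = 0}. order \<alpha> H)"
      by (rule sum.mono_neutral_right) (use F \<open>H \<noteq> 0\<close> in \<open>auto simp: order_root\<close>)
    also have "\<dots> \<le> (\<Sum>\<alpha> | poly H \<alpha> = 0. order \<alpha> H)"
      by (rule sum_mono2) (use poly_roots_finite[OF \<open>H \<noteq> 0\<close>] in auto)
    also have "\<dots> \<le> J" using sum_order_le_degree[OF \<open>H \<noteq> 0\<close>] degH by simp
    finally have 1: "card F * (M - M') \<le> J" .
    have "card F * M \<le> card F * (M - M') + card F * M'"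
      by (metis add_mult_distrib2 le_diff_conv mult_le_mono2 order_refl)
    also have "\<dots> \<le> J + (d - J)" using 1 T[OF M'] by linarith
    finally show ?case using J(1) by simp
  qed
qed simp

section \<open>Sections by generic forms\<close>

context lin_space
begin

text \<open>Independence of a set ignores repetitions in the family, hence the separate conclusion
  on injectivity.\<close>

lemma independent_familyI:
  fixes x :: "nat \<Rightarrow> 'b"
  assumes "\<And>c i. (\<Sum>i<r. scale (c i) (x i)) = 0 \<Longrightarrow> i < r \<Longrightarrow> c i = 0"
  shows "inj_on x {..<r}" and "independent (x ` {..<r})"
proof -
  show inj: "inj_on x {..<r}"
  proof (rule inj_onI, rule ccontr)
    fix i j assume ij: "i \<in> {..<r}" "j \<in> {..<r}" "x i = x j" "i \<noteq> j"
    define c :: "nat \<Rightarrow> 'a" where "c l = (if l = i then 1 else 0) - (if l = j then 1 else 0)" for l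
    have "(\<Sum>l<r. scale (c l) (x l)) = (\<Sum>l<r. (if l = i then x l else 0) - (if l = j then x l else 0))"
      by (rule sum.cong) (auto simp: c_def scale_left_diff_distrib)
    also have "\<dots> = 0" using ij by (simp add: sum_subtractf)
    finally have "c i = 0" using assms ij by blast
    thus False using ij by (simp add: c_def)
  qed
  show "independent (x ` {..<r})"
  proof (rule independent_if_scalars_zero)
    fix f y assume f: "(\<Sum>y\<in>x ` {..<r}. scale (f y) y) = 0" and y: "y \<in> x ` {..<r}"
    have "(\<Sum>i<r. scale (f (x i)) (x i)) = 0" using f by (simp add: sum.reindex[OF inj])
    thus "f y = 0" using assms[of "\<lambda>i. f (x i)"] y by auto
  qed simp
qed

lemma independent_list_coeffs_zero:
  assumes "distinct L" "independent (set L)" "(\<Sum>i<length L. scale (c i) (L ! i)) = 0" "i < length L"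
  shows "c i = 0"
proof -
  have bij: "bij_betw ((!) L) {..<length L} (set L)" using bij_betw_nth[OF assms(1)] by simp
  define e where "e = the_inv_into {..<length L} ((!) L)"
  have e: "e (L ! i) = i" if "i < length L" for i
    unfolding e_def using bij that by (intro the_inv_into_f_f) (auto simp: bij_betw_def)
  have "(\<Sum>v\<in>set L. scale (c (e v)) v) = (\<Sum>i<length L. scale (c i) (L ! i))"
    by (subst sum.reindex_bij_betw[OF bij, symmetric]) (simp add: e)
  hence "(\<Sum>v\<in>set L. scale (c (e v)) v) = 0" using assms(3) by simp
  from independentD[OF assms(2) finite_set subset_refl this, of "L ! i"]
  show ?thesis using assms(4) e by simp
qed

text \<open>A linear relation between the \<open>x i\<close> would be a kernel vector of the
  transposed matrix. Thus a nonzero minor bounds a rank from below.\<close>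

lemma det_functionals_le_dim:
  fixes x :: "nat \<Rightarrow> 'b"
  assumes U: "fin_dim U" "\<And>i. i < r \<Longrightarrow> x i \<in> U"
    and \<phi>: "\<And>j. Vector_Spaces.linear scale (*) (\<phi> j)"
    and det: "Determinant.det (Matrix.mat r r (\<lambda>(i, j). \<phi> j (x i))) \<noteq> 0"
  shows "r \<le> dim U"
proof -
  have triv: "c i = 0" if c: "(\<Sum>i<r. scale (c i) (x i)) = 0" and i: "i < r" for c i
  proof (rule ccontr)
    assume nz: "c i \<noteq> 0"
    let ?M = "Matrix.mat r r (\<lambda>(i, j). \<phi> j (x i))"
    let ?v = "Matrix.vec r c"
    have "vec_index ?v i \<noteq> vec_index (0\<^sub>v r) i" using nz i by simp
    hence "?v \<noteq> 0\<^sub>v r" by auto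
    moreover have "transpose_mat ?M *\<^sub>v ?v = 0\<^sub>v r"
    proof (rule eq_vecI)
      fix j assume j: "j < dim_vec (0\<^sub>v r)"
      interpret l: Vector_Spaces.linear scale "(*)" "\<phi> j" by fact
      have "vec_index (transpose_mat ?M *\<^sub>v ?v) j = (\<Sum>i<r. c i * \<phi> j (x i))"
        using j by (simp add: scalar_prod_def atLeast0LessThan mult.commute)
      also have "\<dots> = \<phi> j (\<Sum>i<r. scale (c i) (x i))" by (simp add: l.sum l.scale)
      finally show "vec_index (transpose_mat ?M *\<^sub>v ?v) j = vec_index (0\<^sub>v r) j"
        using c j by (simp add: l.zero)
    qed simp
    ultimately have "Determinant.det (transpose_mat ?M) = 0"
      by (subst det_0_iff_vec_prod_zero_field[of _ r]) (auto intro!: exI[of _ ?v])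
    moreover have "Determinant.det (transpose_mat ?M) = Determinant.det ?M"
      by (rule Determinant.det_transpose[OF mat_carrier])
    ultimately show False using det by simp
  qed
  have inj: "inj_on x {..<r}" and ind: "independent (x ` {..<r})"
    using independent_familyI[of x r] triv by blast+
  have "card (x ` {..<r}) \<le> dim U"
    by (rule independent_le_dim[OF U(1) ind]) (use U(2) in auto)
  thus ?thesis by (simp add: card_image[OF inj])
qed

text \<open>Singles out a maximal minor whose matrix at \<open>A\<close> is the identity. When
  \<open>A\<close> is perturbed, the same \<open>u\<close> and \<open>\<phi>\<close> give a
  determinant that is polynomial in the perturbation and not identically zero.\<close>

lemma image_dual_frame:
  assumes W: "fin_dim W" and A: "Vector_Spaces.linear scale scale A"
  shows "\<exists>u \<phi>. (\<forall>i<dim (A ` W). u i \<in> W) \<and> (\<forall>j :: nat. Vector_Spaces.linear scale (*) (\<phi> j)) \<and>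
    (\<forall>i<dim (A ` W). \<forall>j<dim (A ` W). \<phi> j (A (u i)) = (if i = j then 1 else 0))"
proof -
  interpret E: lin_space_pair scale scale by unfold_locales
  obtain C where C: "finite C" "independent C" "C \<subseteq> A ` W" "card C = dim (A ` W)"
    by (rule fin_dim_basis[OF E.rank_nullity(1)[OF A W]])
  obtain L where L: "set L = C" "distinct L" using finite_distinct_list[OF C(1)] by blast
  have len: "length L = dim (A ` W)" using distinct_card[OF L(2)] L(1) C(4) by simp
  obtain \<psi> where \<psi>: "\<And>b. Vector_Spaces.linear scale (*) (\<psi> b)"
    "\<And>b c. b \<in> C \<Longrightarrow> c \<in> C \<Longrightarrow> \<psi> b c = (if b = c then 1 else 0)"
    using dual_functional_exists[OF C(2)] by blast
  have "\<forall>i. \<exists>u. i < length L \<longrightarrow> u \<in> W \<and> A u = L ! i"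
  proof
    fix i
    have "L ! i \<in> A ` W" if "i < length L" using nth_mem[OF that] C(3) L(1) by blast
    thus "\<exists>u. i < length L \<longrightarrow> u \<in> W \<and> A u = L ! i" by (metis imageE)
  qed
  from choice[OF this] obtain u where u: "\<And>i. i < length L \<Longrightarrow> u i \<in> W \<and> A (u i) = L ! i" by blast
  show ?thesis
    by (rule exI[of _ u], rule exI[of _ "\<lambda>j. \<psi> (L ! j)"])
       (use u \<psi> L in \<open>auto simp: len[symmetric] nth_eq_iff_index_eq\<close>)
qed

text \<open>The minor singled out at \<open>A\<close> is a polynomial in \<open>s\<close> with value
  1 at \<open>s = 0\<close>. Away from its finitely many roots the rank is at least that of
  \<open>A\<close>.\<close>

lemma pencil_kernel_generic:
  assumes W: "fin_dim W" and A: "Vector_Spaces.linear scale scale A" and B: "Vector_Spaces.linear scale scale B"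
  shows "\<exists>S. finite S \<and> (\<forall>s. s \<notin> S \<longrightarrow> dim {v \<in> W. A v + scale s (B v) = 0} \<le> dim {v \<in> W. A v = 0})"
proof -
  interpret E: lin_space_pair scale scale by unfold_locales
  define r where "r = dim (A ` W)"
  obtain u \<phi> where u: "\<And>i. i < r \<Longrightarrow> u i \<in> W"
    and \<phi>: "\<And>j :: nat. Vector_Spaces.linear scale (*) (\<phi> j)"
    and dual: "\<And>i j. i < r \<Longrightarrow> j < r \<Longrightarrow> \<phi> j (A (u i)) = (if i = j then 1 else 0)"
    using image_dual_frame[OF W A] unfolding r_def by blast
  define P where "P = Matrix.mat r r (\<lambda>(i, j). [:\<phi> j (A (u i)), \<phi> j (B (u i)):])"
  have ev: "poly (Determinant.det P) s = Determinant.det (Matrix.mat r r (\<lambda>(i, j). \<phi> j (A (u i) + scale s (B (u i)))))" for s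
  proof -
    interpret h: comm_ring_hom "\<lambda>p. poly p s" by unfold_locales auto
    have "poly (Determinant.det P) s = Determinant.det (map_mat (\<lambda>p. poly p s) P)" by (rule h.hom_det[symmetric])
    also have "map_mat (\<lambda>p. poly p s) P = Matrix.mat r r (\<lambda>(i, j). \<phi> j (A (u i) + scale s (B (u i))))"
      using \<phi> by (intro eq_matI) (auto simp: P_def Vector_Spaces.linear_iff)
    finally show ?thesis .
  qed
  have "Matrix.mat r r (\<lambda>(i, j). \<phi> j (A (u i) + scale 0 (B (u i)))) = 1\<^sub>m r"
    by (rule eq_matI) (auto simp: dual)
  hence "poly (Determinant.det P) 0 = 1" by (simp only: ev det_one)
  hence nz: "Determinant.det P \<noteq> 0" by auto
  show ?thesis
  proof (intro exI[of _ "{s. poly (Determinant.det P) s = 0}"] conjI allI impI)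
    show "finite {s. poly (Determinant.det P) s = 0}" using poly_roots_finite[OF nz] .
    fix s assume "s \<notin> {s. poly (Determinant.det P) s = 0}"
    hence d: "Determinant.det (Matrix.mat r r (\<lambda>(i, j). \<phi> j (A (u i) + scale s (B (u i))))) \<noteq> 0"
      using ev by simp
    let ?C = "\<lambda>v. A v + scale s (B v)"
    have C: "Vector_Spaces.linear scale scale ?C"
      by (intro E.linear_compose_add E.linear_compose_scale_right A B)
    have "r \<le> dim (?C ` W)"
      by (rule det_functionals_le_dim[OF E.rank_nullity(1)[OF C W] _ \<phi> d]) (use u in auto)
    thus "dim {v \<in> W. ?C v = 0} \<le> dim {v \<in> W. A v = 0}"
      using E.rank_nullity(2)[OF A W] E.rank_nullity(2)[OF C W] by (simp add: r_def)
  qed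
qed

text \<open>The index set is a parameter because the induction on the number of variables discards
  operators.\<close>

definition form :: "('i \<Rightarrow> 'b \<Rightarrow> 'b) \<Rightarrow> 'i set \<Rightarrow> ('i \<Rightarrow> 'a) \<Rightarrow> 'b \<Rightarrow> 'b"
  where "form T B t v = (\<Sum>i\<in>B. scale (t i) (T i v))"

lemma form_add: "form T B (\<lambda>i. t i + s * t' i) v = form T B t v + scale s (form T B t' v)"
  by (simp add: form_def scale_left_distrib sum.distrib scale_sum_right)

lemma linear_form:
  assumes "\<And>i. Vector_Spaces.linear scale scale (T i)"
  shows "Vector_Spaces.linear scale scale (form T B t)"
proof -
  interpret E: lin_space_pair scale scale by unfold_locales
  show ?thesis unfolding form_def
    by (intro E.linear_compose_sum ballI E.linear_compose_scale_right assms)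
qed

text \<open>Minimisers \<open>t1\<close> for the old subspaces and \<open>t2\<close> for the new one
  combine to \<open>t1 + s * t2\<close>. Up to the factor \<open>s\<close> this is also the
  perturbation \<open>t2 + inverse s * t1\<close> of \<open>t2\<close>, so every demand excludes
  only finitely many \<open>s\<close>.\<close>

lemma generic_form_exists:
  assumes inf: "infinite (UNIV :: 'a set)"
    and T: "\<And>i. Vector_Spaces.linear scale scale (T i)"
    and "finite Ws" "\<And>W. W \<in> Ws \<Longrightarrow> fin_dim W"
  shows "\<exists>t. \<forall>W\<in>Ws. \<forall>t'. dim {v \<in> W. form T B t v = 0} \<le> dim {v \<in> W. form T B t' v = 0}"
  using assms(3,4)
proof (induction Ws rule: finite_induct)
  case (insert W0 Ws)
  note lf = linear_form[of T, OF T]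
  let ?k = "\<lambda>W t. dim {v \<in> W. form T B t v = 0}"
  have "\<exists>t. \<forall>W\<in>Ws. \<forall>t'. ?k W t \<le> ?k W t'" by (rule insert.IH) (use insert.prems in auto)
  then obtain t1 where t1: "\<And>W t'. W \<in> Ws \<Longrightarrow> ?k W t1 \<le> ?k W t'" by blast
  obtain t2 where t2: "\<And>t'. ?k W0 t2 \<le> ?k W0 t'"
    using ex_has_least_nat[of "\<lambda>_. True" undefined "?k W0"] by blast
  have "\<forall>W. \<exists>S. W \<in> Ws \<longrightarrow> finite S \<and> (\<forall>s. s \<notin> S \<longrightarrow> ?k W (\<lambda>i. t1 i + s * t2 i) \<le> ?k W t1)"
  proof
    fix W
    show "\<exists>S. W \<in> Ws \<longrightarrow> finite S \<and> (\<forall>s. s \<notin> S \<longrightarrow> ?k W (\<lambda>i. t1 i + s * t2 i) \<le> ?k W t1)"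
    proof (cases "W \<in> Ws")
      case True
      hence "fin_dim W" using insert.prems by blast
      from pencil_kernel_generic[OF this lf lf] show ?thesis unfolding form_add using True by simp
    qed blast
  qed
  from choice[OF this] obtain S where S: "\<And>W. W \<in> Ws \<Longrightarrow> finite (S W)"
    "\<And>W s. W \<in> Ws \<Longrightarrow> s \<notin> S W \<Longrightarrow> ?k W (\<lambda>i. t1 i + s * t2 i) \<le> ?k W t1" by blast
  obtain S0 where S0: "finite S0" "\<And>s. s \<notin> S0 \<Longrightarrow> ?k W0 (\<lambda>i. t2 i + s * t1 i) \<le> ?k W0 t2"
    using pencil_kernel_generic[OF insert.prems[OF insertI1] lf lf, of B t2 B t1]
    unfolding form_add by blast
  have "finite (insert 0 (inverse ` S0 \<union> (\<Union>W\<in>Ws. S W)))"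
    using S S0 insert.hyps by auto
  from ex_new_if_finite[OF inf this]
  obtain s where s: "s \<noteq> 0" "s \<notin> inverse ` S0" "\<And>W. W \<in> Ws \<Longrightarrow> s \<notin> S W" by blast
  define t where "t = (\<lambda>i. t1 i + s * t2 i)"
  have "form T B t v = scale s (form T B (\<lambda>i. t2 i + inverse s * t1 i) v)" for v
    unfolding t_def form_add using s(1) by (simp add: scale_right_distrib add.commute)
  hence "?k W0 t = ?k W0 (\<lambda>i. t2 i + inverse s * t1 i)" using s(1) by simp
  also have "\<dots> \<le> ?k W0 t2" by (rule S0(2)) (use s(2) imageI[of "inverse s" S0 inverse] in auto)
  finally have "?k W0 t \<le> ?k W0 t'" for t' using t2 le_trans by blast
  moreover have "?k W t \<le> ?k W t'" if "W \<in> Ws" for W t'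
    using S(2)[OF that s(3)[OF that]] t1[OF that] le_trans unfolding t_def by blast
  ultimately show ?case by blast
qed auto

text \<open>
  The subspace \<open>W\<close> plays the part of Macaulay's inverse system of an ideal \<open>I\<close>: the kernel and the
  image of a form \<open>h\<close> on \<open>W\<close> correspond to the ideals \<open>I + (h)\<close> and \<open>I : h\<close>.
\<close>

theorem generic_section_bound:
  fixes T :: "'i \<Rightarrow> 'b \<Rightarrow> 'b"
  assumes inf: "infinite (UNIV :: 'a set)"
    and T: "\<And>i. Vector_Spaces.linear scale scale (T i)"
    and comm: "\<And>i j v. T i (T j v) = T j (T i v)"
    and "finite B" "card B = Suc k" "fin_dim W" "\<And>i v. i \<in> B \<Longrightarrow> v \<in> W \<Longrightarrow> T i v \<in> W"
    and "dim {v \<in> W. \<forall>i\<in>B. T i v = 0} \<le> 1"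
    and "\<And>t. c \<le> dim {v \<in> W. form T B t v = 0}"
  shows "real c \<le> (exp 1 * real (dim W)) powr (real k / real (Suc k))"
  using assms(4-)
proof (induction k arbitrary: B W c)
  case 0
  then obtain b where b: "B = {b}" by (auto simp: card_Suc_eq)
  have "c \<le> dim {v \<in> W. T b v = 0}" using "0.prems"(6)[of "\<lambda>_. 1"] by (simp add: form_def b)
  also have "\<dots> \<le> 1" using "0.prems"(5) by (simp add: b)
  finally have "c \<le> 1" .
  \<comment> \<open>The exponent is 0 and \<open>0 powr 0 = 0\<close>, so the case
    \<open>dim W = 0\<close> requires this second bound.\<close>
  moreover have "c \<le> dim W"
    using "0.prems"(6)[of "\<lambda>_. 1"] dim_le[OF "0.prems"(3), of "{v \<in> W. form T B (\<lambda>_. 1) v = 0}"] by auto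
  ultimately show ?case by auto
next
  case (Suc k)
  interpret E: lin_space_pair scale scale by unfold_locales
  note lf = linear_form[of T, OF T]
  from Suc.prems show ?case
  \<comment> \<open>The image of a form keeps all operators but has smaller dimension, which calls
    for this inner induction. The kernel of a form loses an operator and falls under the hypothesis
    for \<open>k\<close>.\<close>
  proof (induction "dim W" arbitrary: W c rule: less_induct)
    case less
    define f where "f = form T B"
    have f: "Vector_Spaces.linear scale scale (f t)" for t unfolding f_def by (rule lf)
    have fT: "f t (T i v) = T i (f t v)" for t i v
      unfolding f_def form_def
      by (simp add: comm E.linear_sum[OF T] E.linear_scale[OF T])
    have ff: "f t (f t' v) = f t' (f t v)" for t t' v
      using E.linear_sum[OF f, of t "\<lambda>i. scale (t' i) (T i v)" B] 
      by (simp add: E.linear_scale[OF f] fT) (simp add: f_def form_def)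
    note W = less.prems(3) and inv = less.prems(4)
    have fW: "f t v \<in> W" if "v \<in> W" for t v
      unfolding f_def form_def using that inv fin_dim_subspace[OF W]
      by (intro subspace_sum subspace_scale) auto
    have subK: "fin_dim {v \<in> W. f t v = 0}" for t
    proof (rule fin_dim_subset[OF W])
      have "{v \<in> W. f t v = 0} = W \<inter> {v. f t v = 0}" by auto
      thus "subspace {v \<in> W. f t v = 0}"
        using subspace_inter[OF fin_dim_subspace[OF W] E.linear_subspace_kernel[OF f]] by simp
    qed auto
    define d2 where "d2 t t' = dim {v \<in> W. f t v = 0 \<and> f t' v = 0}" for t t'
    \<comment> \<open>\<open>t1\<close> has to be fixed before \<open>t2\<close>, since
      \<open>W0\<close> and \<open>W1\<close> depend on it. Taken from a minimising pair, it ensures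
      that a \<open>t2\<close> generic on \<open>W0\<close> makes \<open>d2 t1 t2\<close> minimal
      among all pairs.\<close>
    obtain t1 u2 where min2: "\<And>t t'. d2 t1 u2 \<le> d2 t t'"
    proof -
      obtain z where z: "\<And>y. d2 (fst z) (snd z) \<le> d2 (fst y) (snd y)"
        using ex_has_least_nat[of "\<lambda>_. True" undefined "\<lambda>z. d2 (fst z) (snd z)"] by blast
      show ?thesis by (rule that[of "fst z" "snd z"]) (use z[of "(_, _)"] in simp)
    qed
    define W0 where "W0 = {v \<in> W. f t1 v = 0}"
    define W1 where "W1 = f t1 ` W"
    have W0: "fin_dim W0" unfolding W0_def by (rule subK)
    have W1: "fin_dim W1" unfolding W1_def by (rule E.rank_nullity(1)[OF f W])
    have "\<exists>t. \<forall>U\<in>{W, W0, W1}. \<forall>t'. dim {v \<in> U. f t v = 0} \<le> dim {v \<in> U. f t' v = 0}"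
      unfolding f_def by (rule generic_form_exists[OF inf T]) (use W W0 W1 in auto)
    then obtain t2 where t2:
      "\<forall>U\<in>{W, W0, W1}. \<forall>t'. dim {v \<in> U. f t2 v = 0} \<le> dim {v \<in> U. f t' v = 0}" ..
    have
      gW: "\<And>t'. dim {v \<in> W. f t2 v = 0} \<le> dim {v \<in> W. f t' v = 0}" and
      gW0: "\<And>t'. dim {v \<in> W0. f t2 v = 0} \<le> dim {v \<in> W0. f t' v = 0}" and
      gW1: "\<And>t'. dim {v \<in> W1. f t2 v = 0} \<le> dim {v \<in> W1. f t' v = 0}"
      using t2 by simp_all
    define W2 where "W2 = {v \<in> W. f t2 v = 0}"
    have W2: "fin_dim W2" unfolding W2_def by (rule subK)
    define c0 where "c0 = dim W2"
    define c' where "c' = d2 t1 t2"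
    define c1 where "c1 = dim {v \<in> W1. f t2 v = 0}"
    have c0: "c \<le> c0" using less.prems(6)[of t2] by (simp add: c0_def W2_def f_def)
    have c'_le: "c' \<le> d2 t t'" for t t'
    proof -
      have "c' \<le> d2 t1 u2" using gW0[of u2] by (simp add: c'_def d2_def W0_def conj_assoc)
      thus ?thesis using min2 le_trans by blast
    qed
    have dimW: "dim W = dim W1 + dim W0"
      using E.rank_nullity(2)[OF f W, of t1] by (simp add: W0_def W1_def)
    have W0_ge: "c0 \<le> dim W0" using gW by (simp add: c0_def W0_def W2_def)
    \<comment> \<open>Apply \<open>t1\<close> to the kernel of \<open>t2\<close>: as forms commute,
      the image lies in the kernel of \<open>t2\<close> on \<open>W1\<close>, and what is lost is
      the common kernel.\<close>
    have sub: "c0 \<le> c1 + c'"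
    proof -
      have "c0 = dim (f t1 ` W2) + dim {v \<in> W2. f t1 v = 0}"
        unfolding c0_def by (rule E.rank_nullity(2)[OF f W2])
      also have "{v \<in> W2. f t1 v = 0} = {v \<in> W. f t1 v = 0 \<and> f t2 v = 0}" by (auto simp: W2_def)
      also have "dim (f t1 ` W2) \<le> c1"
        unfolding c1_def
      proof (rule dim_le)
        show "f t1 ` W2 \<subseteq> {v \<in> W1. f t2 v = 0}"
          by (auto simp: W1_def W2_def ff[of t2] E.linear_0[OF f])
        have "{v \<in> W1. f t2 v = 0} = W1 \<inter> {v. f t2 v = 0}" by auto
        thus "fin_dim {v \<in> W1. f t2 v = 0}"
          using fin_dim_subset[OF W1] subspace_inter[OF fin_dim_subspace[OF W1] E.linear_subspace_kernel[OF f]]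
          by auto
      qed
      finally show ?thesis by (simp add: c'_def d2_def)
    qed
    have soc: "dim U \<le> 1" if "U \<subseteq> {v \<in> W. \<forall>i\<in>B. T i v = 0}" for U
    proof -
      have "subspace {v \<in> W. \<forall>i\<in>B. T i v = 0}"
        using fin_dim_subspace[OF W]
        by (auto simp: subspace_def E.linear_0[OF T] E.linear_add[OF T] E.linear_scale[OF T])
      hence "fin_dim {v \<in> W. \<forall>i\<in>B. T i v = 0}" by (rule fin_dim_subset[OF W]) auto
      thus ?thesis using dim_le[OF _ that] less.prems(5) by (meson le_trans)
    qed
    show ?case
    \<comment> \<open>Outside these cases \<open>W1\<close> is strictly smaller than
      \<open>W\<close>, and \<open>t2\<close> is nonzero.\<close>
    proof (cases "c0 = 0 \<or> dim W \<le> 1")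
      case True
      have "c0 \<le> dim W" using W0_ge dimW by simp
      hence "c \<le> 1" "c \<le> dim W" using True c0 by auto
      moreover have "1 \<le> (exp 1 * real (dim W)) powr (real (Suc k) / real (Suc (Suc k)))" if "dim W > 0"
      proof (rule ge_one_powr_ge_zero)
        have "1 * 1 \<le> exp (1::real) * real (dim W)" using that by (intro mult_mono) auto
        thus "1 \<le> exp 1 * real (dim W)" by simp
      qed simp
      ultimately show ?thesis
        by (cases "dim W = 0") (auto intro: order.trans[of _ 1])
    next
      case False
      \<comment> \<open>If \<open>t2\<close> were zero, minimality would force every form to vanish
        on \<open>W\<close>, in particular each operator, and \<open>W\<close> would lie in the
        common kernel.\<close>
      have ex: "\<exists>j\<in>B. t2 j \<noteq> 0"
      proof (rule ccontr)
        assume "\<not> ?thesis"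
        hence "f t2 v = 0" for v by (simp add: f_def form_def)
        hence "W2 = W" by (simp add: W2_def)
        hence le: "dim W \<le> dim {v \<in> W. f t v = 0}" for t using gW[of t] by (simp add: W2_def)
        have im: "dim (f t ` W) = 0" for t using E.rank_nullity(2)[OF f W, of t] le[of t] by simp
        have z: "f t v = 0" if v: "v \<in> W" for t v
        proof -
          obtain C where C: "finite C" "span C = f t ` W" "card C = dim (f t ` W)"
            by (rule fin_dim_basis[OF E.rank_nullity(1)[OF f[of t] W]])
          hence "C = {}" using im by simp
          hence "f t ` W = {0}" using C(2) by simp
          thus ?thesis using v by blast
        qed
        have "T i v = 0" if "v \<in> W" "i \<in> B" for v i
        proof -
          have "f (\<lambda>j. if j = i then 1 else 0) v = (\<Sum>j\<in>B. if j = i then T j v else 0)"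
            unfolding f_def form_def by (rule sum.cong) auto
          also have "\<dots> = T i v" using that less.prems(1) by simp
          finally show ?thesis using z[OF that(1)] by simp
        qed
        hence "dim W \<le> 1" using soc[of W] by auto
        thus False using False by simp
      qed
      then obtain j where j: "j \<in> B" "t2 j \<noteq> 0" by blast
      define B' where "B' = B - {j}"
      have fB: "f t v = scale (t j) (T j v) + form T B' t v" for t v
        unfolding f_def form_def B'_def using less.prems(1) j(1) by (simp add: sum.remove)
      have h1: "real c1 \<le> (exp 1 * real (dim W1)) powr (real (Suc k) / real (Suc (Suc k)))"
      proof (rule less.hyps)
        show "dim W1 < dim W" using dimW W0_ge False by simp
        show "T i v \<in> W1" if "i \<in> B" "v \<in> W1" for i v
          using that inv by (auto simp: W1_def fT[symmetric])
        show "dim {v \<in> W1. \<forall>i\<in>B. T i v = 0} \<le> 1" by (rule soc) (auto simp: W1_def fW)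
        show "c1 \<le> dim {v \<in> W1. form T B t v = 0}" for t
          using gW1[of t] by (simp add: c1_def f_def)
      qed (use less.prems W1 in auto)
      have h2: "real c' \<le> (exp 1 * real (dim W2)) powr (real k / real (Suc k))"
      proof (rule Suc.IH)
        show "finite B'" "card B' = Suc k" using less.prems(1,2) j by (auto simp: B'_def)
        show "T i v \<in> W2" if "i \<in> B'" "v \<in> W2" for i v
          using that inv by (auto simp: W2_def fT B'_def E.linear_0[OF T])
        show "dim {v \<in> W2. \<forall>i\<in>B'. T i v = 0} \<le> 1"
        proof (rule soc, clarify, intro conjI ballI)
          fix v i assume v: "v \<in> W2" "\<forall>i\<in>B'. T i v = 0" and i: "i \<in> B"
          have "form T B' t2 v = 0" using v(2) by (simp add: form_def)
          hence "scale (t2 j) (T j v) = 0" using v(1) fB[of t2 v] by (simp add: W2_def)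
          hence "T j v = 0" using j by simp
          thus "T i v = 0" using v(2) i by (cases "i = j") (auto simp: B'_def)
        qed (auto simp: W2_def)
        \<comment> \<open>A form without \<open>j\<close> is a form on \<open>B\<close> with
          coefficient 0 at \<open>j\<close>. The pair starts with \<open>t2\<close> instead of
          \<open>t1\<close>, which is why \<open>c'\<close> had to be minimal over all
          pairs.\<close>
        show "c' \<le> dim {v \<in> W2. form T B' t v = 0}" for t
        proof -
          have "form T B' (t(j := 0)) v = form T B' t v" for v
            unfolding form_def by (rule sum.cong) (auto simp: B'_def)
          hence "f (t(j := 0)) v = form T B' t v" for v using fB[of "t(j := 0)" v] by simp
          hence "{v \<in> W2. form T B' t v = 0} = {v \<in> W. f t2 v = 0 \<and> f (t(j := 0)) v = 0}"
            by (auto simp: W2_def)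
          thus ?thesis using c'_le[of t2 "t(j := 0)"] by (simp add: d2_def)
        qed
      qed (rule W2)
      have "real c0 \<le> (exp 1 * real (dim W)) powr (real (Suc k) / real (Suc (Suc k)))"
        by (rule section_bound_step[of _ "real c'" "real (dim W1)"])
           (use h1 h2 sub W0_ge dimW in \<open>auto simp: c0_def\<close>)
      thus ?thesis using c0 by simp
    qed
  qed
qed

end

section \<open>Sections by forms on a grid\<close>

lemma sum_fun_apply: "(\<Sum>i\<in>A. g i) x = (\<Sum>i\<in>A. g i x)"
  by (induction A rule: infinite_finite_induct) auto

text \<open>Serves both the coefficient vectors of linear relations and the functionals on
  polynomials.\<close>

interpretation fun_space: lin_space "\<lambda>(c :: 'a::field) (f :: 'i \<Rightarrow> 'a) x. c * f x"
  by unfold_locales (auto simp: fun_eq_iff algebra_simps)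

text \<open>A model of the vectors of length \<open>r\<close> inside a type that does not depend on
  \<open>r\<close>.\<close>

lemma dim_truncated_functions:
  fixes r :: nat
  defines "V \<equiv> {f :: nat \<Rightarrow> 'a::field. \<forall>x\<ge>r. f x = 0}"
  shows "fun_space.fin_dim V" "fun_space.dim V = r"
proof -
  define e :: "nat \<Rightarrow> nat \<Rightarrow> 'a" where "e i x = (if x = i then 1 else 0)" for i x
  have comb: "(\<Sum>i<r. (\<lambda>x. c i * e i x)) x = (if x < r then c x else 0)" for c :: "nat \<Rightarrow> 'a" and x
    unfolding sum_fun_apply e_def by (simp add: if_distrib[of "\<lambda>y. _ * y"] cong: if_cong)
  have triv: "c i = 0" if "(\<Sum>i<r. (\<lambda>x. c i * e i x)) = 0" "i < r" for c i
    using comb[of c i] that by simp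
  have inj: "inj_on e {..<r}" and ind: "fun_space.independent (e ` {..<r})"
    using fun_space.independent_familyI[of e r] triv by blast+
  have sub: "V \<subseteq> fun_space.span (e ` {..<r})"
  proof
    fix f assume "f \<in> V"
    hence "f = (\<Sum>i<r. (\<lambda>x. f i * e i x))" by (auto simp: V_def comb fun_eq_iff)
    also have "\<dots> \<in> fun_space.span (e ` {..<r})"
      by (intro fun_space.span_sum fun_space.span_scale fun_space.span_base) auto
    finally show "f \<in> fun_space.span (e ` {..<r})" .
  qed
  have "fun_space.subspace V" by (auto simp: fun_space.subspace_def V_def)
  thus "fun_space.fin_dim V" using sub by (auto simp: fun_space.fin_dim_def)
  show "fun_space.dim V = r"
    by (rule fun_space.dim_unique[OF _ sub ind]) (auto simp: V_def e_def card_image[OF inj])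
qed

text \<open>The relations between the \<open>w j\<close> are the kernel of a map from an
  \<open>r\<close>-dimensional space to \<open>Y\<close>, so there are at least \<open>k\<close>
  independent ones. A basis of them, extended to a basis of the whole space, provides the
  rows.\<close>

lemma (in lin_space) invertible_with_relation_rows:
  fixes w :: "nat \<Rightarrow> 'b"
  assumes Y: "fin_dim Y" "\<And>j. j < r \<Longrightarrow> w j \<in> Y" and le: "dim Y + k \<le> r"
  shows "\<exists>t. Determinant.det (Matrix.mat r r (\<lambda>(i, j). t i j)) \<noteq> 0 \<and>
    (\<forall>i<k. (\<Sum>j<r. scale (t i j) (w j)) = 0)"
proof -
  interpret P: lin_space_pair "\<lambda>(c :: 'a) (f :: nat \<Rightarrow> 'a) x. c * f x" scale by unfold_locales
  define V where "V = {f :: nat \<Rightarrow> 'a. \<forall>x\<ge>r. f x = 0}"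
  note V = dim_truncated_functions[where r = r and ?'a = 'a, folded V_def]
  define \<psi> where "\<psi> f = (\<Sum>j<r. scale (f j) (w j))" for f
  have \<psi>: "Vector_Spaces.linear (\<lambda>(c :: 'a) (f :: nat \<Rightarrow> 'a) x. c * f x) scale \<psi>"
    unfolding Vector_Spaces.linear_iff using vector_space_axioms fun_space.vector_space_axioms
    by (auto simp: \<psi>_def scale_left_distrib sum.distrib scale_sum_right)
  define N where "N = {f \<in> V. \<psi> f = 0}"
  have "\<psi> ` V \<subseteq> Y" unfolding \<psi>_def using Y fin_dim_subspace[OF Y(1)]
    by (auto intro!: subspace_sum subspace_scale)
  hence "dim (\<psi> ` V) \<le> dim Y" by (rule dim_le[OF Y(1)])
  hence kN: "k \<le> fun_space.dim N" using P.rank_nullity(2)[OF \<psi> V(1)] V(2) le by (simp add: N_def)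
  have "N = V \<inter> {f. \<psi> f = 0}" by (auto simp: N_def)
  hence N: "fun_space.fin_dim N"
    using fun_space.fin_dim_subset[OF V(1)] fun_space.subspace_inter[OF fun_space.fin_dim_subspace[OF V(1)] P.linear_subspace_kernel[OF \<psi>]]
    by auto
  obtain A where A: "finite A" "fun_space.independent A" "A \<subseteq> N" "card A = fun_space.dim N"
    by (rule fun_space.fin_dim_basis[OF N])
  have "A \<subseteq> V" using A(3) by (auto simp: N_def)
  then obtain C where C: "A \<subseteq> C" "C \<subseteq> V" "fun_space.independent C" "V \<subseteq> fun_space.span C"
    using fun_space.maximal_independent_subset_extend[OF _ A(2)] by metis
  have finC: "finite C" by (rule fun_space.independent_le_dim(1)[OF V(1) C(3,2)])
  have cardC: "card C = r" using fun_space.basis_card_eq_dim[OF C(2,4,3)] V(2) by simp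
  obtain L1 where L1: "set L1 = A" "distinct L1" using finite_distinct_list[OF A(1)] by blast
  obtain L2 where L2: "set L2 = C - A" "distinct L2" using finite_distinct_list[of "C - A"] finC by blast
  \<comment> \<open>The relations come first, so that they occupy the first \<open>k\<close>
    rows.\<close>
  define L where "L = L1 @ L2"
  have L: "set L = C" "distinct L" using L1 L2 C(1) by (auto simp: L_def)
  have len: "length L = r" using distinct_card[OF L(2)] L(1) cardC by simp
  have len1: "k \<le> length L1" using distinct_card[OF L1(2)] L1(1) A(4) kN by simp
  let ?M = "Matrix.mat r r (\<lambda>(i, j). (L ! i) j)"
  have "Determinant.det ?M \<noteq> 0"
  proof
    assume "Determinant.det ?M = 0"
    hence "Determinant.det (transpose_mat ?M) = 0"
      by (simp add: Determinant.det_transpose[OF mat_carrier])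
    then obtain v where v: "v \<in> carrier_vec r" "v \<noteq> 0\<^sub>v r" "transpose_mat ?M *\<^sub>v v = 0\<^sub>v r"
      using det_0_iff_vec_prod_zero_field[of "transpose_mat ?M" r] by auto
    define c where "c = vec_index v"
    have "(\<Sum>i<length L. (\<lambda>x. c i * (L ! i) x)) = 0"
    proof
      fix x
      show "(\<Sum>i<length L. (\<lambda>x. c i * (L ! i) x)) x = 0 x"
      proof (cases "x < r")
        case True
        have "vec_index (transpose_mat ?M *\<^sub>v v) x = (\<Sum>i<r. c i * (L ! i) x)"
          using True v(1) by (simp add: scalar_prod_def atLeast0LessThan c_def mult.commute)
        thus ?thesis using v(3) True by (simp add: sum_fun_apply len)
      next
        case False
        have "(L ! i) x = 0" if "i < length L" for i
          using nth_mem[OF that] L(1) C(2) False by (auto simp: V_def)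
        thus ?thesis by (simp add: sum_fun_apply)
      qed
    qed
    hence "c i = 0" if "i < r" for i
      using fun_space.independent_list_coeffs_zero[OF L(2), of c i] L(1) C(3) that len by simp
    hence "v = 0\<^sub>v r" using v(1) by (intro eq_vecI) (auto simp: c_def)
    thus False using v(2) by simp
  qed
  moreover have "(\<Sum>j<r. scale ((L ! i) j) (w j)) = 0" if "i < k" for i
  proof -
    have "L ! i \<in> A" using that len1 nth_mem[of i L1] L1(1) by (simp add: L_def nth_append)
    hence "\<psi> (L ! i) = 0" using A(3) by (auto simp: N_def)
    thus ?thesis by (simp add: \<psi>_def)
  qed
  ultimately show ?thesis by (intro exI[of _ "\<lambda>i. L ! i"]) simp
qed

text \<open>Multiplication by the invertible matrix \<open>t\<close> kills the first
  \<open>k\<close> rows of the constant part, so these rows of the product are divisible by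
  \<open>s\<close>. \<open>P\<close> is what remains after \<open>s\<close> is taken out of
  each.\<close>

lemma det_pencil_vanishes:
  fixes A B t :: "nat \<Rightarrow> nat \<Rightarrow> 'a::field"
  assumes t: "Determinant.det (Matrix.mat r r (\<lambda>(i, j). t i j)) \<noteq> 0" and k: "k \<le> r"
    and z: "\<And>i j. i < k \<Longrightarrow> j < r \<Longrightarrow> (\<Sum>l<r. t i l * A l j) = 0"
  shows "\<exists>p. \<forall>s. Determinant.det (Matrix.mat r r (\<lambda>(i, j). A i j + s * B i j)) = s ^ k * poly p s"
proof -
  let ?T = "Matrix.mat r r (\<lambda>(i, j). t i j)"
  define a where "a i j = (\<Sum>l<r. t i l * A l j)" for i j
  define b where "b i j = (\<Sum>l<r. t i l * B l j)" for i j
  define P where "P = Matrix.mat r r (\<lambda>(i, j). if i < k then [:b i j:] else [:a i j, b i j:])"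
  have "Determinant.det ?T * Determinant.det (Matrix.mat r r (\<lambda>(i, j). A i j + s * B i j))
      = s ^ k * poly (Determinant.det P) s" for s
  proof -
    interpret h: comm_ring_hom "\<lambda>p. poly p s" by unfold_locales auto
    let ?M = "Matrix.mat r r (\<lambda>(i, j). A i j + s * B i j)"
    define c where "c i = (if i < k then s else 1)" for i
    define v where "v i = Matrix.vec r (\<lambda>j. if i < k then b i j else a i j + s * b i j)" for i
    have "Determinant.det ?T * Determinant.det ?M = Determinant.det (?T * ?M)"
      by (rule Determinant.det_mult[symmetric, of _ r]) auto
    also have "?T * ?M = mat\<^sub>r r r (\<lambda>i. c i \<cdot>\<^sub>v v i)"
    proof (rule eq_matI)
      fix i j assume "i < dim_row (mat\<^sub>r r r (\<lambda>i. c i \<cdot>\<^sub>v v i))" "j < dim_col (mat\<^sub>r r r (\<lambda>i. c i \<cdot>\<^sub>v v i))"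
      hence ij: "i < r" "j < r" by auto
      have "(?T * ?M) $$ (i, j) = (\<Sum>l<r. t i l * (A l j + s * B l j))"
        using ij by (simp add: scalar_prod_def atLeast0LessThan)
      also have "\<dots> = a i j + s * b i j"
        by (simp add: a_def b_def distrib_left sum.distrib sum_distrib_left mult.left_commute)
      also have "\<dots> = mat\<^sub>r r r (\<lambda>i. c i \<cdot>\<^sub>v v i) $$ (i, j)"
        using ij z[of i j] by (auto simp: c_def v_def a_def)
      finally show "(?T * ?M) $$ (i, j) = mat\<^sub>r r r (\<lambda>i. c i \<cdot>\<^sub>v v i) $$ (i, j)" .
    qed auto
    also have "Determinant.det \<dots> = prod c {0..<r} * Determinant.det (mat\<^sub>r r r v)"
      by (rule Determinant.det_rows_mul) (auto simp: v_def)
    also have "mat\<^sub>r r r v = map_mat (\<lambda>p. poly p s) P"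
      by (rule eq_matI) (auto simp: v_def P_def)
    also have "Determinant.det \<dots> = poly (Determinant.det P) s" by (rule h.hom_det)
    also have "prod c {0..<r} = (\<Prod>i<k. s)"
      unfolding c_def by (rule prod.mono_neutral_cong_right) (use k in auto)
    finally show ?thesis by simp
  qed
  hence "Determinant.det (Matrix.mat r r (\<lambda>(i, j). A i j + s * B i j))
      = s ^ k * poly (smult (inverse (Determinant.det ?T)) (Determinant.det P)) s" for s
    using t by (simp add: field_simps)
  thus ?thesis by blast
qed

lemma polyfun_det:
  assumes "\<And>i j. i < r \<Longrightarrow> j < r \<Longrightarrow> polyfun xs 1 (m i j)"
  shows "polyfun xs r (\<lambda>t. Determinant.det (Matrix.mat r r (\<lambda>(i, j). m i j t)))"
proof -
  have "polyfun xs r (\<lambda>t. \<Sum>p | p permutes {0..<r}. signof p * (\<Prod>i = 0..<r. m i (p i) t))"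
  proof (rule polyfun_sum)
    fix p assume "p \<in> {p. p permutes {0..<r}}"
    hence p: "p i < r" if "i < r" for i using that permutes_in_image[of p "{0..<r}" i] by auto
    have "polyfun xs (card {0..<r}) (\<lambda>t. \<Prod>i\<in>{0..<r}. m i (p i) t)"
      by (rule polyfun_prod) (use assms p in auto)
    thus "polyfun xs r (\<lambda>t. signof p * (\<Prod>i = 0..<r. m i (p i) t))"
      using polyfun_mult[OF polyfun_const[of xs 0 "signof p"]] by simp
  qed
  also have "(\<lambda>t. \<Sum>p | p permutes {0..<r}. signof p * (\<Prod>i = 0..<r. m i (p i) t))
      = (\<lambda>t. Determinant.det (Matrix.mat r r (\<lambda>(i, j). m i j t)))"
  proof
    fix t
    show "(\<Sum>p | p permutes {0..<r}. signof p * (\<Prod>i = 0..<r. m i (p i) t))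
      = Determinant.det (Matrix.mat r r (\<lambda>(i, j). m i j t))"
      unfolding det_def'[OF mat_carrier]
    proof (intro sum.cong arg_cong2[of _ _ _ _ "(*)"] prod.cong refl)
      fix p i assume "p \<in> {p. p permutes {0..<r}}" "i \<in> {0..<r}"
      hence "i < r" "p i < r" using permutes_in_image[of p "{0..<r}" i] by auto
      thus "m i (p i) t = Matrix.mat r r (\<lambda>(i, j). m i j t) $$ (i, p i)" by simp
    qed
  qed
  finally show ?thesis .
qed

text \<open>
  A maximal minor of the pencil of forms, of degree the generic rank, vanishes at each point of the
  grid to the order by which the rank drops there.
\<close>

theorem (in lin_space) kernel_dim_on_grid:
  fixes T :: "'i \<Rightarrow> 'b \<Rightarrow> 'b"
  assumes inf: "infinite (UNIV :: 'a set)" and F: "finite F"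
    and T: "\<And>i. Vector_Spaces.linear scale scale (T i)" and W: "fin_dim W"
    and xs: "distinct xs"
    and m: "\<And>a. (\<And>i. a i \<in> F) \<Longrightarrow> m \<le> dim {v \<in> W. form T (set xs) a v = 0}"
  shows "card F * (m - dim {v \<in> W. form T (set xs) t v = 0}) \<le> dim W - dim {v \<in> W. form T (set xs) t v = 0}"
proof -
  interpret E: lin_space_pair scale scale by unfold_locales
  define f where "f = form T (set xs)"
  have f: "Vector_Spaces.linear scale scale (f t)" for t unfolding f_def by (rule linear_form[of T, OF T])
  define r where "r = dim (f t ` W)"
  define m' where "m' = dim {v \<in> W. f t v = 0}"
  have rm: "dim W = r + m'" using E.rank_nullity(2)[OF f W, of t] by (simp add: r_def m'_def)
  have "card F * (m - m') \<le> r"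
  proof (cases "m \<le> m'")
    case False
    obtain u \<phi> where u: "\<And>i. i < r \<Longrightarrow> u i \<in> W"
      and \<phi>: "\<And>j :: nat. Vector_Spaces.linear scale (*) (\<phi> j)"
      and dual: "\<And>i j. i < r \<Longrightarrow> j < r \<Longrightarrow> \<phi> j (f t (u i)) = (if i = j then 1 else 0)"
      using image_dual_frame[OF W f] unfolding r_def by blast
    interpret G: vector_space_pair scale "(*) :: 'a \<Rightarrow> 'a \<Rightarrow> 'a"
      using \<phi>[of 0] by (simp add: vector_space_pair_def Vector_Spaces.linear_def)
    define D where "D t = Determinant.det (Matrix.mat r r (\<lambda>(i, j). \<phi> j (f t (u i))))" for t
    have "Matrix.mat r r (\<lambda>(i, j). \<phi> j (f t (u i))) = 1\<^sub>m r"
      by (rule eq_matI) (auto simp: dual)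
    hence Dt: "D t \<noteq> 0" by (simp add: D_def)
    have poly: "polyfun xs r D"
      unfolding D_def
    proof (rule polyfun_det)
      fix i j
      have "(\<lambda>t. \<phi> j (f t (u i))) = (\<lambda>t. \<Sum>x\<in>set xs. t x * \<phi> j (T x (u i)))"
        by (simp add: f_def form_def G.linear_sum[OF \<phi>] G.linear_scale[OF \<phi>])
      moreover have "polyfun xs 1 (\<lambda>t. t x * \<phi> j (T x (u i)))" if "x \<in> set xs" for x
        using polyfun_mult[OF polyfun_var[OF that] polyfun_const[of xs 0]] by simp
      ultimately show "polyfun xs 1 (\<lambda>t. \<phi> j (f t (u i)))"
        by (simp only: polyfun_sum)
    qed
    have van: "vanishes_to_order D a (m - m')" if a: "\<And>i. a i \<in> F" for a
      unfolding vanishes_to_order_def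
    proof
      fix b
      have "m \<le> dim {v \<in> W. f a v = 0}" using m[OF a] by (simp add: f_def)
      \<comment> \<open>At a grid point the rank falls short of \<open>r\<close> by at least
        \<open>m - m'\<close>. So many independent relations hold between the images
        \<open>f a (u j)\<close>.\<close>
      hence "dim (f a ` W) + (m - m') \<le> r"
        using E.rank_nullity(2)[OF f W, of a] rm False by linarith
      from invertible_with_relation_rows[OF E.rank_nullity(1)[OF f W] _ this, of "\<lambda>j. f a (u j)"] u
      obtain c where c: "Determinant.det (Matrix.mat r r (\<lambda>(i, j). c i j)) \<noteq> 0"
        "\<And>i. i < m - m' \<Longrightarrow> (\<Sum>j<r. scale (c i j) (f a (u j))) = 0" by auto
      have "(\<Sum>l<r. c i l * \<phi> j (f a (u l))) = \<phi> j (\<Sum>l<r. scale (c i l) (f a (u l)))" for i j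
        by (simp add: G.linear_sum[OF \<phi>] G.linear_scale[OF \<phi>])
      hence "\<exists>p. \<forall>s. Determinant.det (Matrix.mat r r (\<lambda>(i, j). \<phi> j (f a (u i)) + s * \<phi> j (f b (u i))))
          = s ^ (m - m') * poly p s"
        by (intro det_pencil_vanishes[OF c(1)])
           (use c(2) \<open>dim (f a ` W) + (m - m') \<le> r\<close> in \<open>auto simp: G.linear_0[OF \<phi>]\<close>)
      thus "\<exists>p. \<forall>s. D (\<lambda>i. a i + s * b i) = s ^ (m - m') * poly p s"
        by (simp add: D_def f_def form_add G.linear_add[OF \<phi>] G.linear_scale[OF \<phi>])
    qed
    show ?thesis
      by (rule multiplicity_schwartz_zippel[OF inf F xs poly Dt van])
  qed simp
  thus ?thesis using rm by (simp add: m'_def f_def)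
qed

section \<open>Quotients of polynomial rings\<close>

abbreviation mpoly_coset :: "('n, 'a::field) mpoly set \<Rightarrow> ('n, 'a) mpoly \<Rightarrow> ('n, 'a) mpoly set"
  where "mpoly_coset J f \<equiv> J +>\<^bsub>mpoly_ring\<^esub> f"

lemma mpoly_ring_simps [simp]:
  "carrier mpoly_ring = UNIV" "x \<otimes>\<^bsub>mpoly_ring\<^esub> y = x * y" "x \<oplus>\<^bsub>mpoly_ring\<^esub> y = x + y"
  "\<zero>\<^bsub>mpoly_ring\<^esub> = 0" "\<one>\<^bsub>mpoly_ring\<^esub> = 1"
  by (simp_all add: ring_of_type_algebra_def)

lemma ring_mpoly_ring: "ring (mpoly_ring :: ('n, 'a::field) mpoly ring)"
  by (rule ring_from_type_algebra)

lemma ideal_mpoly_iff: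
  fixes J :: "('n, 'a::field) mpoly set"
  shows "ideal J mpoly_ring \<longleftrightarrow> 0 \<in> J \<and> (\<forall>a\<in>J. \<forall>b\<in>J. a + b \<in> J) \<and> (\<forall>a\<in>J. \<forall>f. f * a \<in> J)"
proof
  assume J: "ideal J mpoly_ring"
  note A = ideal.axioms(1)[OF J]
  show "0 \<in> J \<and> (\<forall>a\<in>J. \<forall>b\<in>J. a + b \<in> J) \<and> (\<forall>a\<in>J. \<forall>f. f * a \<in> J)"
    using additive_subgroup.zero_closed[OF A] additive_subgroup.a_closed[OF A] ideal.I_l_closed[OF J] by auto
next
  assume J: "0 \<in> J \<and> (\<forall>a\<in>J. \<forall>b\<in>J. a + b \<in> J) \<and> (\<forall>a\<in>J. \<forall>f. f * a \<in> J)"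
  interpret R: ring "mpoly_ring :: ('n, 'a) mpoly ring" by (rule ring_mpoly_ring)
  have inv: "inv\<^bsub>add_monoid mpoly_ring\<^esub> a = - a" for a :: "('n, 'a) mpoly"
    using R.minus_equality[of "- a" a] by (simp add: a_inv_def)
  have neg: "- a \<in> J" if "a \<in> J" for a
  proof -
    have "(- 1) * a \<in> J" using J that by blast
    thus ?thesis by simp
  qed
  have "subgroup J (add_monoid mpoly_ring)"
  proof (rule group.subgroupI[OF R.a_group])
    show "inv\<^bsub>add_monoid mpoly_ring\<^esub> a \<in> J" if "a \<in> J" for a
      unfolding inv by (rule neg[OF that])
  qed (use J in auto)
  thus "ideal J mpoly_ring"
    by (rule idealI[OF ring_mpoly_ring]) (use J in \<open>auto simp: mult.commute\<close>)
qed

lemma ideal_mpoly_diff: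
  assumes "ideal J mpoly_ring" "a \<in> J" "b \<in> J"
  shows "a - b \<in> J"
proof -
  have "(- 1) * b \<in> J" using assms unfolding ideal_mpoly_iff by blast
  hence "a + (- 1) * b \<in> J" using assms unfolding ideal_mpoly_iff by blast
  thus ?thesis by simp
qed

lemma mpoly_coset_eq_iff:
  assumes "ideal J mpoly_ring"
  shows "mpoly_coset J f = mpoly_coset J g \<longleftrightarrow> f - g \<in> J"
proof -
  have c: "mpoly_coset J h = (\<lambda>j. j + h) ` J" for h
    by (auto simp: a_r_coset_def r_coset_def)
  note D = assms[unfolded ideal_mpoly_iff]
  show ?thesis
  proof
    assume eq: "mpoly_coset J f = mpoly_coset J g"
    have "f \<in> mpoly_coset J f" using D unfolding c by (auto intro!: image_eqI[of _ _ 0])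
    hence "f \<in> mpoly_coset J g" using eq by simp
    thus "f - g \<in> J" by (auto simp: c)
  next
    assume fg: "f - g \<in> J"
    hence gf: "g - f \<in> J" using ideal_mpoly_diff[OF assms, of 0 "f - g"] D by simp
    show "mpoly_coset J f = mpoly_coset J g"
      unfolding c
    proof safe
      fix j assume "j \<in> J"
      hence "j + (f - g) \<in> J" "j + (g - f) \<in> J" using fg gf D by blast+
      thus "j + f \<in> (\<lambda>j. j + g) ` J" "j + g \<in> (\<lambda>j. j + f) ` J"
        using image_eqI[of "j + f" "\<lambda>j. j + g" "j + (f - g)" J]
          image_eqI[of "j + g" "\<lambda>j. j + f" "j + (g - f)" J] by simp_all
    qed
  qed
qed

lemma mpoly_coset_ops:
  assumes "ideal J (mpoly_ring :: ('n, 'a::field) mpoly ring)"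
  shows "mpoly_coset J f \<oplus>\<^bsub>mpoly_ring Quot J\<^esub> mpoly_coset J g = mpoly_coset J (f + g)"
    and "mpoly_coset J f \<otimes>\<^bsub>mpoly_ring Quot J\<^esub> mpoly_coset J g = mpoly_coset J (f * g)"
    and "\<zero>\<^bsub>mpoly_ring Quot J\<^esub> = mpoly_coset J 0"
    and "carrier (mpoly_ring Quot J) = range (mpoly_coset J)"
proof -
  interpret ideal J "mpoly_ring :: ('n, 'a) mpoly ring" by fact
  show "mpoly_coset J f \<oplus>\<^bsub>mpoly_ring Quot J\<^esub> mpoly_coset J g = mpoly_coset J (f + g)"
    using ring_hom_add[OF rcos_ring_hom, of f g] by simp
  show "mpoly_coset J f \<otimes>\<^bsub>mpoly_ring Quot J\<^esub> mpoly_coset J g = mpoly_coset J (f * g)"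
    using ring_hom_mult[OF rcos_ring_hom, of f g] by simp
  show "\<zero>\<^bsub>mpoly_ring Quot J\<^esub> = mpoly_coset J 0"
    by (simp add: FactRing_def a_r_coset_def r_coset_def)
  show "carrier (mpoly_ring Quot J) = range (mpoly_coset J)"
    by (auto simp: FactRing_def A_RCOSETS_def')
qed

section \<open>Dimension of a quotient through explicit linear combinations\<close>

lemma mpoly_const_simps:
  "mpoly_const 0 = (0 :: ('n, 'a::field) mpoly)" "mpoly_const 1 = (1 :: ('n, 'a) mpoly)"
  "mpoly_const (a + b) = (mpoly_const a + mpoly_const b :: ('n, 'a) mpoly)"
  "mpoly_const (a - b) = (mpoly_const a - mpoly_const b :: ('n, 'a) mpoly)"
  "mpoly_const (a * b) = (mpoly_const a * mpoly_const b :: ('n, 'a) mpoly)"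
  by (simp_all add: mpoly_const_def single_add single_diff mult_single)

text \<open>Describes by coefficients the spans that \<open>ring.dimension\<close> builds up by
  \<open>line_extension\<close>.\<close>

definition mpoly_comb :: "nat \<Rightarrow> (nat \<Rightarrow> ('n, 'a::field) mpoly) \<Rightarrow> (nat \<Rightarrow> 'a) \<Rightarrow> ('n, 'a) mpoly"
  where "mpoly_comb r p c = (\<Sum>i<r. mpoly_const (c i) * p i)"

lemma mpoly_comb_add: "mpoly_comb r p (\<lambda>i. c i + d i) = mpoly_comb r p c + mpoly_comb r p d"
  by (simp add: mpoly_comb_def mpoly_const_simps distrib_right sum.distrib)

lemma mpoly_comb_diff: "mpoly_comb r p (\<lambda>i. c i - d i) = mpoly_comb r p c - mpoly_comb r p d"
  by (simp add: mpoly_comb_def mpoly_const_simps left_diff_distrib sum_subtractf)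

lemma mpoly_comb_scale: "mpoly_comb r p (\<lambda>i. a * c i) = mpoly_const a * mpoly_comb r p c"
  by (simp add: mpoly_comb_def mpoly_const_simps sum_distrib_left mult.assoc)

lemma line_extension_mpoly_coset:
  assumes J: "ideal J (mpoly_ring :: ('n, 'a::field) mpoly ring)"
  shows "ring.line_extension (mpoly_ring Quot J) (quot_scalars J) (mpoly_coset J (p r))
      (range (\<lambda>c. mpoly_coset J (mpoly_comb r p c))) = range (\<lambda>c. mpoly_coset J (mpoly_comb (Suc r) p c))"
    (is "?L = ?R")
proof -
  interpret Q: ring "mpoly_ring Quot J" by (rule ideal.quotient_is_ring[OF J])
  show ?thesis
  proof (intro equalityI subsetI)
    fix x assume "x \<in> ?L"
    then obtain a c where "x = mpoly_coset J (mpoly_const a) \<otimes>\<^bsub>mpoly_ring Quot J\<^esub> mpoly_coset J (p r)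
        \<oplus>\<^bsub>mpoly_ring Quot J\<^esub> mpoly_coset J (mpoly_comb r p c)"
      unfolding Q.line_extension_mem_iff by (auto simp: quot_scalars_def)
    hence "x = mpoly_coset J (mpoly_comb (Suc r) p (c(r := a)))"
      by (simp add: mpoly_coset_ops[OF J] mpoly_comb_def add.commute)
    thus "x \<in> ?R" by blast
  next
    fix x assume "x \<in> ?R"
    then obtain c where "x = mpoly_coset J (mpoly_comb (Suc r) p c)" by blast
    hence "x = mpoly_coset J (mpoly_const (c r)) \<otimes>\<^bsub>mpoly_ring Quot J\<^esub> mpoly_coset J (p r)
        \<oplus>\<^bsub>mpoly_ring Quot J\<^esub> mpoly_coset J (mpoly_comb r p c)"
      by (simp add: mpoly_coset_ops[OF J] mpoly_comb_def add.commute)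
    thus "x \<in> ?L"
      unfolding Q.line_extension_mem_iff by (auto simp: quot_scalars_def)
  qed
qed

lemma mpoly_comb_fun_upd: "r \<le> s \<Longrightarrow> mpoly_comb r (p(s := f)) c = mpoly_comb r p c"
  by (simp add: mpoly_comb_def)

text \<open>Each step of the inductive \<open>dimension\<close> adjoins a class outside the span so
  far. A combination in \<open>J\<close> with nonzero last coefficient could be solved for that
  class and would put it into the span.\<close>

lemma quot_dimension_basis:
  assumes J: "ideal J (mpoly_ring :: ('n, 'a::field) mpoly ring)"
    and "ring.dimension (mpoly_ring Quot J) r (quot_scalars J) E"
  shows "\<exists>p. E = range (\<lambda>c. mpoly_coset J (mpoly_comb r p c)) \<and>
    (\<forall>c. mpoly_comb r p c \<in> J \<longrightarrow> (\<forall>i<r. c i = 0))"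
proof -
  interpret Q: ring "mpoly_ring Quot J" by (rule ideal.quotient_is_ring[OF J])
  have "K = quot_scalars J \<Longrightarrow> ?thesis" if "Q.dimension r K E" for K
    using that
  proof (induction rule: Q.dimension.induct)
    case (zero_dim K)
    show ?case by (auto simp: mpoly_comb_def mpoly_coset_ops[OF J])
  next
    case (Suc_dim v E r K)
    then obtain p where E: "E = range (\<lambda>c. mpoly_coset J (mpoly_comb r p c))"
      and ind: "\<And>c i. mpoly_comb r p c \<in> J \<Longrightarrow> i < r \<Longrightarrow> c i = 0" by blast
    obtain f where v: "v = mpoly_coset J f" using Suc_dim(1) by (auto simp: mpoly_coset_ops[OF J])
    define p' where "p' = p(r := f)"
    have cp: "mpoly_comb r p' c = mpoly_comb r p c" for c by (simp add: p'_def mpoly_comb_fun_upd)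
    have "Q.line_extension K v E = range (\<lambda>c. mpoly_coset J (mpoly_comb (Suc r) p' c))"
      using line_extension_mpoly_coset[OF J, of p' r] Suc_dim by (simp add: E v cp) (simp add: p'_def)
    moreover have "c i = 0" if c: "mpoly_comb (Suc r) p' c \<in> J" and i: "i < Suc r" for c i
    proof -
      have eq: "mpoly_comb (Suc r) p' c = mpoly_comb r p c + mpoly_const (c r) * f"
        by (simp add: mpoly_comb_def p'_def)
      have "c r = 0"
      proof (rule ccontr)
        assume nz: "c r \<noteq> 0"
        define d where "d i = - inverse (c r) * c i" for i
        have "mpoly_const (inverse (c r)) * mpoly_comb (Suc r) p' c \<in> J"
          using J c unfolding ideal_mpoly_iff by blast
        also have "mpoly_const (inverse (c r)) * mpoly_comb (Suc r) p' c = f - mpoly_comb r p d"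
        proof -
          have "mpoly_const (inverse (c r)) * (mpoly_const (c r) * f) = f"
            using nz by (simp add: mult.assoc[symmetric] mpoly_const_simps(5)[symmetric] mpoly_const_simps(2))
          moreover have "mpoly_const (inverse (c r)) * mpoly_comb r p c = - mpoly_comb r p d"
            using mpoly_comb_scale[of r p "inverse (c r)" c] mpoly_comb_diff[of r p "\<lambda>_. 0" "\<lambda>i. inverse (c r) * c i"]
            by (simp add: d_def mpoly_comb_def mpoly_const_simps)
          ultimately show ?thesis unfolding eq distrib_left by simp
        qed
        finally have "v = mpoly_coset J (mpoly_comb r p d)"
          unfolding v mpoly_coset_eq_iff[OF J] .
        thus False using Suc_dim(2) E by blast
      qed
      moreover from this have "mpoly_comb r p c \<in> J" using c eq by (simp add: mpoly_const_simps)
      ultimately show ?thesis using ind i by (cases "i = r") auto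
    qed
    ultimately show ?case by blast
  qed
  thus ?thesis using assms(2) by blast
qed

text \<open>Thins out a generating family: a generator already in the span is skipped, any other
  extends it by one dimension.\<close>

lemma quot_dimension_exists:
  assumes J: "ideal J (mpoly_ring :: ('n, 'a::field) mpoly ring)"
  shows "\<exists>d. ring.dimension (mpoly_ring Quot J) d (quot_scalars J) (range (\<lambda>c. mpoly_coset J (mpoly_comb r p c)))"
proof (induction r)
  case 0
  interpret Q: ring "mpoly_ring Quot J" by (rule ideal.quotient_is_ring[OF J])
  show ?case using Q.zero_dim[of "quot_scalars J"] by (auto simp: mpoly_comb_def mpoly_coset_ops[OF J])
next
  case (Suc r)
  interpret Q: ring "mpoly_ring Quot J" by (rule ideal.quotient_is_ring[OF J])
  let ?E = "\<lambda>r. range (\<lambda>c. mpoly_coset J (mpoly_comb r p c))"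
  obtain d where d: "Q.dimension d (quot_scalars J) (?E r)" using Suc by blast
  show ?case
  proof (cases "mpoly_coset J (p r) \<in> ?E r")
    case False
    have "Q.dimension (Suc d) (quot_scalars J) (Q.line_extension (quot_scalars J) (mpoly_coset J (p r)) (?E r))"
      by (rule Q.Suc_dim) (use False d in \<open>auto simp: mpoly_coset_ops[OF J]\<close>)
    thus ?thesis unfolding line_extension_mpoly_coset[OF J] by blast
  next
    case True
    then obtain b where "mpoly_coset J (p r) = mpoly_coset J (mpoly_comb r p b)" by blast
    hence b: "p r - mpoly_comb r p b \<in> J" by (simp add: mpoly_coset_eq_iff[OF J])
    have "mpoly_coset J (mpoly_comb (Suc r) p c) = mpoly_coset J (mpoly_comb r p (\<lambda>i. c i + c r * b i))" for c
    proof -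
      have "mpoly_const (c r) * (p r - mpoly_comb r p b) \<in> J"
        using J b unfolding ideal_mpoly_iff by blast
      thus ?thesis unfolding mpoly_coset_eq_iff[OF J] mpoly_comb_add mpoly_comb_scale
        by (simp add: mpoly_comb_def right_diff_distrib)
    qed
    hence "?E (Suc r) \<subseteq> ?E r" by auto
    moreover have "?E r \<subseteq> ?E (Suc r)"
    proof (rule image_subsetI)
      fix c
      have "mpoly_comb r p c = mpoly_comb (Suc r) p (c(r := 0))"
        by (simp add: mpoly_comb_def mpoly_const_simps)
      thus "mpoly_coset J (mpoly_comb r p c) \<in> ?E (Suc r)" by simp
    qed
    ultimately show ?thesis using d by (metis equalityI)
  qed
qed

text \<open>Representatives that span modulo \<open>I\<close> still span modulo \<open>J\<close>.
  Only this gives a meaning to \<open>quot_dim\<close> for the sections, as it rests on a definite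
  description.\<close>

lemma quot_finite_dim_mono:
  assumes I: "ideal I (mpoly_ring :: ('n, 'a::field) mpoly ring)" and J: "ideal J mpoly_ring"
    and "I \<subseteq> J" "quot_finite_dim I"
  shows "quot_finite_dim J"
proof -
  interpret QI: ring "mpoly_ring Quot I" by (rule ideal.quotient_is_ring[OF I])
  interpret QJ: ring "mpoly_ring Quot J" by (rule ideal.quotient_is_ring[OF J])
  obtain r where "QI.dimension r (quot_scalars I) (carrier (mpoly_ring Quot I))"
    using assms(4) by (auto simp: quot_finite_dim_def QI.finite_dimension_def)
  from quot_dimension_basis[OF I this]
  obtain p where p: "range (mpoly_coset I) = range (\<lambda>c. mpoly_coset I (mpoly_comb r p c))"
    by (auto simp: mpoly_coset_ops[OF I])
  have "mpoly_coset J f \<in> range (\<lambda>c. mpoly_coset J (mpoly_comb r p c))" for f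
  proof -
    obtain c where "mpoly_coset I f = mpoly_coset I (mpoly_comb r p c)" using p by blast
    hence "f - mpoly_comb r p c \<in> J" using assms(3) by (auto simp: mpoly_coset_eq_iff[OF I])
    thus ?thesis by (auto simp: mpoly_coset_eq_iff[OF J])
  qed
  hence "carrier (mpoly_ring Quot J) = range (\<lambda>c. mpoly_coset J (mpoly_comb r p c))"
    by (auto simp: mpoly_coset_ops[OF J])
  thus ?thesis using quot_dimension_exists[OF J, of r p]
    by (auto simp: quot_finite_dim_def QJ.finite_dimension_def)
qed

text \<open>
  The inverse system of \<open>J\<close> over the algebraic closure. Passing to functionals performs the base
  change of the quotient without a tensor product.
\<close>

definition quot_dual :: "('n, 'a::field) mpoly set \<Rightarrow> (('n, 'a) mpoly \<Rightarrow> 'a alg_closure) set"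
  where "quot_dual J = {l. (\<forall>f g. l (f + g) = l f + l g) \<and>
    (\<forall>c f. l (mpoly_const c * f) = to_ac c * l f) \<and> (\<forall>f\<in>J. l f = 0)}"

lemma quot_dual_comb:
  assumes "l \<in> quot_dual J"
  shows "l (mpoly_comb r p c) = (\<Sum>i<r. to_ac (c i) * l (p i))"
proof -
  have "l 0 = 0" using assms by (auto simp: quot_dual_def) (metis add_cancel_right_right)
  hence "l (\<Sum>i\<in>A. h i) = (\<Sum>i\<in>A. l (h i))" for A :: "nat set" and h
    using assms by (induction A rule: infinite_finite_induct) (auto simp: quot_dual_def)
  thus ?thesis using assms by (simp add: mpoly_comb_def quot_dual_def)
qed

text \<open>The coordinates modulo \<open>J\<close>, with values moved to the algebraic closure, are
  a basis dual to \<open>p\<close>. They are linear in the polynomial because, by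
  \<open>co_eq\<close>, the choice \<open>co\<close> is forced.\<close>

lemma quot_dual_dim_of_dimension:
  assumes J: "ideal J (mpoly_ring :: ('n, 'a::field) mpoly ring)"
    and d: "ring.dimension (mpoly_ring Quot J) r (quot_scalars J) (carrier (mpoly_ring Quot J))"
  shows "fun_space.fin_dim (quot_dual J)" "fun_space.dim (quot_dual J) = r"
proof -
  note D = J[unfolded ideal_mpoly_iff]
  obtain p where p: "range (mpoly_coset J) = range (\<lambda>c. mpoly_coset J (mpoly_comb r p c))"
    and ind: "\<And>c i. mpoly_comb r p c \<in> J \<Longrightarrow> i < r \<Longrightarrow> c i = 0"
    using quot_dimension_basis[OF J d] by (auto simp: mpoly_coset_ops[OF J])
  have "\<forall>f. \<exists>c. f - mpoly_comb r p c \<in> J"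
  proof
    fix f
    have "mpoly_coset J f \<in> range (\<lambda>c. mpoly_coset J (mpoly_comb r p c))" using p by blast
    thus "\<exists>c. f - mpoly_comb r p c \<in> J" by (auto simp: mpoly_coset_eq_iff[OF J])
  qed
  from choice[OF this] obtain co where co: "\<And>f. f - mpoly_comb r p (co f) \<in> J" by blast
  have co_eq: "co f i = c i" if "f - mpoly_comb r p c \<in> J" "i < r" for f c i
  proof -
    have "mpoly_comb r p (\<lambda>i. co f i - c i) = (f - mpoly_comb r p c) - (f - mpoly_comb r p (co f))"
      by (simp add: mpoly_comb_diff)
    hence "mpoly_comb r p (\<lambda>i. co f i - c i) \<in> J"
      using ideal_mpoly_diff[OF J that(1) co[of f]] by simp
    from ind[OF this that(2)] show ?thesis by simp
  qed
  define e where "e i f = to_ac (co f i)" for i f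
  have e_dual: "e i \<in> quot_dual J" if i: "i < r" for i
  proof -
    have "co (f + g) i = co f i + co g i" for f g
    proof (rule co_eq[OF _ i])
      have "(f - mpoly_comb r p (co f)) + (g - mpoly_comb r p (co g)) \<in> J" using co D by blast
      thus "f + g - mpoly_comb r p (\<lambda>i. co f i + co g i) \<in> J"
        by (simp add: mpoly_comb_add algebra_simps)
    qed
    moreover have "co (mpoly_const a * f) i = a * co f i" for a f
    proof (rule co_eq[OF _ i])
      have "mpoly_const a * (f - mpoly_comb r p (co f)) \<in> J" using co D by blast
      thus "mpoly_const a * f - mpoly_comb r p (\<lambda>i. a * co f i) \<in> J"
        by (simp add: mpoly_comb_scale right_diff_distrib)
    qed
    moreover have "co f i = 0" if "f \<in> J" for f
      by (rule co_eq[OF _ i]) (use that in \<open>simp add: mpoly_comb_def mpoly_const_simps\<close>)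
    ultimately show ?thesis by (auto simp: quot_dual_def e_def)
  qed
  have e_p: "e i (p j) = (if i = j then 1 else 0)" if "i < r" "j < r" for i j
  proof -
    have "mpoly_comb r p (\<lambda>i. if i = j then 1 else 0) = (\<Sum>i<r. if i = j then p i else 0)"
      unfolding mpoly_comb_def by (rule sum.cong) (auto simp: mpoly_const_simps)
    also have "\<dots> = p j" using that by simp
    finally have "p j - mpoly_comb r p (\<lambda>i. if i = j then 1 else 0) \<in> J" using D by simp
    from co_eq[OF this that(1)] show ?thesis by (simp add: e_def)
  qed
  have triv: "c i = 0" if "(\<Sum>i<r. (\<lambda>f. c i * e i f)) = 0" "i < r" for c i
  proof -
    have "(\<Sum>i<r. (\<lambda>f. c i * e i f)) (p i) = (\<Sum>j<r. if j = i then c j else 0)"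
      unfolding sum_fun_apply by (rule sum.cong) (use that(2) in \<open>auto simp: e_p\<close>)
    thus ?thesis using that by simp
  qed
  have inj: "inj_on e {..<r}" and ind': "fun_space.independent (e ` {..<r})"
    using fun_space.independent_familyI[of e r] triv by blast+
  have sub: "quot_dual J \<subseteq> fun_space.span (e ` {..<r})"
  proof
    fix l assume l: "l \<in> quot_dual J"
    have "l = (\<Sum>i<r. (\<lambda>f. l (p i) * e i f))"
    proof
      fix f
      have "l f = l ((f - mpoly_comb r p (co f)) + mpoly_comb r p (co f))" by simp
      also have "\<dots> = l (f - mpoly_comb r p (co f)) + l (mpoly_comb r p (co f))"
        using l unfolding quot_dual_def by blast
      also have "l (f - mpoly_comb r p (co f)) = 0" using l co unfolding quot_dual_def by blast
      also have "l (mpoly_comb r p (co f)) = (\<Sum>i<r. l (p i) * e i f)"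
        unfolding quot_dual_comb[OF l] by (simp add: e_def mult.commute)
      finally show "l f = (\<Sum>i<r. (\<lambda>f. l (p i) * e i f)) f" by (simp add: sum_fun_apply)
    qed
    also have "\<dots> \<in> fun_space.span (e ` {..<r})"
      by (intro fun_space.span_sum fun_space.span_scale fun_space.span_base) auto
    finally show "l \<in> fun_space.span (e ` {..<r})" .
  qed
  have "fun_space.subspace (quot_dual J)"
    by (auto simp: fun_space.subspace_def quot_dual_def algebra_simps)
  thus "fun_space.fin_dim (quot_dual J)" using sub by (auto simp: fun_space.fin_dim_def)
  show "fun_space.dim (quot_dual J) = r"
    by (rule fun_space.dim_unique[OF _ sub ind']) (use e_dual in \<open>auto simp: card_image[OF inj]\<close>)
qed

text \<open>The dual is defined without a basis, so its dimension also proves that the number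
  described by \<open>ring.dim\<close> is unique.\<close>

lemma quot_dual_dim:
  assumes J: "ideal J (mpoly_ring :: ('n, 'a::field) mpoly ring)" and "quot_finite_dim J"
  shows "fun_space.fin_dim (quot_dual J)" "fun_space.dim (quot_dual J) = quot_dim J"
proof -
  interpret Q: ring "mpoly_ring Quot J" by (rule ideal.quotient_is_ring[OF J])
  obtain r where r: "Q.dimension r (quot_scalars J) (carrier (mpoly_ring Quot J))"
    using assms(2) by (auto simp: quot_finite_dim_def Q.finite_dimension_def)
  show "fun_space.fin_dim (quot_dual J)" by (rule quot_dual_dim_of_dimension(1)[OF J r])
  have "quot_dim J = r"
    unfolding quot_dim_def Q.dim_def
  proof (rule the_equality)
    show "Q.dimension r (quot_scalars J) (carrier (mpoly_ring Quot J))" by (rule r)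
    fix s assume "Q.dimension s (quot_scalars J) (carrier (mpoly_ring Quot J))"
    thus "s = r" using quot_dual_dim_of_dimension(2)[OF J] r by metis
  qed
  thus "fun_space.dim (quot_dual J) = quot_dim J" using quot_dual_dim_of_dimension(2)[OF J r] by simp
qed

lemma infinite_alg_closed_field: "infinite (UNIV :: 'a::alg_closed_field set)"
proof
  assume fin: "finite (UNIV :: 'a set)"
  define p :: "'a poly" where "p = (\<Prod>a\<in>UNIV. [:-a, 1:])"
  have "degree p = card (UNIV :: 'a set)"
    unfolding p_def by (subst degree_prod_eq_sum_degree) auto
  hence "degree (p + 1) > 0"
    using fin by (subst degree_add_eq_left) (auto simp: finite_UNIV_card_ge_0)
  then obtain x where "poly (p + 1) x = 0" using alg_closed_imp_poly_has_root by blast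
  moreover have "poly p x = 0" using fin by (simp add: p_def poly_prod)
  ultimately show False by simp
qed

section \<open>Variables, evaluation and vanishing ideals\<close>

definition mpoly_var :: "'n \<Rightarrow> ('n, 'a::field) mpoly"
  where "mpoly_var i = Poly_Mapping.single (Poly_Mapping.single i 1) 1"

lemma mpoly_additive_induct [case_names zero add single]:
  fixes f :: "('n, 'a::field) mpoly"
  assumes "P 0" "\<And>f g. P f \<Longrightarrow> P g \<Longrightarrow> P (f + g)" "\<And>t c. P (Poly_Mapping.single t c)"
  shows "P f"
proof -
  have "P (\<Sum>t\<in>A. Poly_Mapping.single t (Poly_Mapping.lookup f t))" for A
    by (induction A rule: infinite_finite_induct) (use assms in auto)
  moreover have "f = (\<Sum>t\<in>Poly_Mapping.keys f. Poly_Mapping.single t (Poly_Mapping.lookup f t))"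
    by (rule poly_mapping_eqI)
       (simp add: lookup_sum lookup_single when_def in_keys_iff if_distrib cong: if_cong)
  ultimately show ?thesis by metis
qed

lemma mpoly_eval_superset:
  assumes "finite A" "Poly_Mapping.keys f \<subseteq> A" "h 0 = 0"
  shows "mpoly_eval h f p = (\<Sum>t\<in>A. h (Poly_Mapping.lookup f t) * (\<Prod>i\<in>UNIV. (p $ i) ^ Poly_Mapping.lookup t i))"
  unfolding mpoly_eval_def by (rule sum.mono_neutral_left) (use assms in \<open>auto simp: in_keys_iff\<close>)

lemma mpoly_eval_add:
  "mpoly_eval to_ac (f + g) p = mpoly_eval to_ac f p + mpoly_eval to_ac g p"
proof -
  let ?A = "Poly_Mapping.keys f \<union> Poly_Mapping.keys g"
  have "Poly_Mapping.keys (f + g) \<subseteq> ?A" by (rule Poly_Mapping.keys_add)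
  thus ?thesis
    by (simp add: mpoly_eval_superset[of ?A] lookup_add distrib_right sum.distrib)
qed

lemma mpoly_eval_single:
  "mpoly_eval to_ac (Poly_Mapping.single t c) p = to_ac c * (\<Prod>i\<in>UNIV. (p $ i) ^ Poly_Mapping.lookup t i)"
  by (subst mpoly_eval_superset[of "{t}"]) auto

lemma mpoly_eval_mult:
  "mpoly_eval to_ac (f * g) p = mpoly_eval to_ac f p * mpoly_eval to_ac g p"
proof (induction f rule: mpoly_additive_induct)
  case (single t c)
  show ?case
  proof (induction g rule: mpoly_additive_induct)
    case (single t' c')
    show ?case by (simp add: mult_single mpoly_eval_single lookup_add power_add prod.distrib)
  qed (simp_all add: mpoly_eval_add distrib_left, simp add: mpoly_eval_def)
qed (simp_all add: mpoly_eval_add distrib_right, simp add: mpoly_eval_def)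

lemma ideal_vanishing_ideal: "ideal (vanishing_ideal V) mpoly_ring"
  unfolding ideal_mpoly_iff vanishing_ideal_def
  by (auto simp: mpoly_eval_add mpoly_eval_mult) (simp add: mpoly_eval_def)

section \<open>Linear forms and hyperplanes\<close>

definition linear_poly :: "('n::finite \<Rightarrow> 'a::field) \<Rightarrow> ('n, 'a) mpoly"
  where "linear_poly a = (\<Sum>i\<in>UNIV. mpoly_const (a i) * mpoly_var i)"

lemma mpoly_eval_linear_poly:
  fixes a :: "'n::finite \<Rightarrow> 'a::field"
  shows "mpoly_eval to_ac (linear_poly a) p = (\<Sum>i\<in>UNIV. to_ac (a i) * p $ i)"
proof -
  have sum: "mpoly_eval to_ac (\<Sum>i\<in>A. h i) p = (\<Sum>i\<in>A. mpoly_eval to_ac (h i) p)" for A and h :: "'n \<Rightarrow> ('n, 'a) mpoly"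
    by (induction A rule: infinite_finite_induct) (auto simp: mpoly_eval_add, auto simp: mpoly_eval_def)
  have "(\<Prod>j\<in>UNIV. (p $ j) ^ (Poly_Mapping.lookup (Poly_Mapping.single i 1) j)) = p $ i" for i
  proof -
    have "(\<Prod>j\<in>UNIV. (p $ j) ^ (Poly_Mapping.lookup (Poly_Mapping.single i 1) j)) = (\<Prod>j\<in>UNIV. if j = i then p $ j else 1)"
      by (rule prod.cong) (auto simp: lookup_single when_def)
    thus ?thesis by simp
  qed
  thus ?thesis
    unfolding linear_poly_def sum
    by (simp add: mpoly_const_def mpoly_var_def mpoly_eval_mult mpoly_eval_single)
qed

text \<open>A linear equation that holds at the rational points persists on their span over the
  algebraic closure.\<close>

lemma linear_poly_in_vanishing_ideal:
  fixes a :: "'n::finite \<Rightarrow> 'a::field"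
  shows "linear_poly a \<in> vanishing_ideal {v. (\<Sum>i\<in>UNIV. a i * v $ i) = 0}"
proof -
  let ?V = "{v. (\<Sum>i\<in>UNIV. a i * v $ i) = 0}"
  have "geometric_points ?V \<subseteq> {p. (\<Sum>i\<in>UNIV. to_ac (a i) * p $ i) = 0}"
    unfolding geometric_points_def
  proof (rule vec.span_minimal)
    have "(\<Sum>i\<in>UNIV. to_ac (a i) * to_ac (v $ i)) = to_ac (\<Sum>i\<in>UNIV. a i * v $ i)" for v :: "'a ^ 'n"
      by (simp add: to_ac_sum)
    thus "(\<lambda>v. \<chi> i. to_ac (v $ i)) ` ?V \<subseteq> {p. (\<Sum>i\<in>UNIV. to_ac (a i) * p $ i) = 0}" by auto
    show "vec.subspace {p. (\<Sum>i\<in>UNIV. to_ac (a i) * p $ i) = 0}"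
      by (auto simp: vec.subspace_def distrib_left sum.distrib mult.left_commute[of "to_ac _"] sum_distrib_left[symmetric])
  qed
  thus ?thesis by (auto simp: vanishing_ideal_def mpoly_eval_linear_poly)
qed

lemma dim_hyperplane:
  fixes a :: "'n::finite \<Rightarrow> 'a::field"
  assumes "a i0 \<noteq> 0"
  shows "vec.subspace {v :: 'a ^ 'n. (\<Sum>i\<in>UNIV. a i * v $ i) = 0}"
    and "vec.dim {v :: 'a ^ 'n. (\<Sum>i\<in>UNIV. a i * v $ i) = 0} = CARD('n) - 1"
proof -
  interpret P: lin_space_pair "(*s) :: 'a \<Rightarrow> 'a ^ 'n \<Rightarrow> 'a ^ 'n" "(*) :: 'a \<Rightarrow> 'a \<Rightarrow> 'a"
    by unfold_locales (auto simp: algebra_simps)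
  define f where "f v = (\<Sum>i\<in>UNIV. a i * v $ i)" for v :: "'a ^ 'n"
  have f: "Vector_Spaces.linear (*s) (*) f"
    unfolding Vector_Spaces.linear_iff
    using lin_space.axioms[OF P.vs1.lin_space_axioms] lin_space.axioms[OF P.vs2.lin_space_axioms]
    by (auto simp: f_def distrib_left sum.distrib sum_distrib_left mult.left_commute)
  have "P.vs1.fin_dim UNIV"
    unfolding P.vs1.fin_dim_def using vec.finite_Basis vec.span_Basis by auto
  from P.rank_nullity(2)[OF f this]
  have "CARD('n) = vector_space_over_itself.dim (range f) + vec.dim {v. f v = 0}"
    using vec.dim_UNIV card_cart_basis[where ?'a = 'a and ?'i = 'n] by simp
  moreover have "vector_space_over_itself.dim (range f) = 1"
  proof -
    have "y \<in> range f" for y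
    proof
      have "f (\<chi> i. if i = i0 then y / a i0 else 0) = (\<Sum>i\<in>UNIV. if i = i0 then y else 0)"
        unfolding f_def by (rule sum.cong) (use assms in auto)
      thus "y = f (\<chi> i. if i = i0 then y / a i0 else 0)" by simp
    qed simp
    hence "range f = UNIV" by blast
    moreover have "vector_space_over_itself.dim UNIV = 1"
      by (rule vector_space_over_itself.dim_unique[of "{1}"]) (auto simp: vector_space_over_itself.span_singleton)
    ultimately show ?thesis by simp
  qed
  ultimately show "vec.dim {v :: 'a ^ 'n. (\<Sum>i\<in>UNIV. a i * v $ i) = 0} = CARD('n) - 1"
    by (simp add: f_def)
  show "vec.subspace {v :: 'a ^ 'n. (\<Sum>i\<in>UNIV. a i * v $ i) = 0}"
    using P.linear_subspace_kernel[OF f] by (simp add: f_def)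
qed

text \<open>The transpose of multiplication by a variable, that is, the contraction by which
  variables act on an inverse system.\<close>

definition var_action :: "'n \<Rightarrow> (('n, 'a::field) mpoly \<Rightarrow> 'a alg_closure) \<Rightarrow> ('n, 'a) mpoly \<Rightarrow> 'a alg_closure"
  where "var_action i l = (\<lambda>f. l (mpoly_var i * f))"

abbreviation form_action :: "('n::finite \<Rightarrow> 'a alg_closure) \<Rightarrow> (('n, 'a::field) mpoly \<Rightarrow> 'a alg_closure) \<Rightarrow> ('n, 'a) mpoly \<Rightarrow> 'a alg_closure"
  where "form_action \<equiv> fun_space.form var_action UNIV"

lemma linear_var_action:
  "Vector_Spaces.linear (\<lambda>c f x. c * f x) (\<lambda>c f x. c * f x) (var_action i)"
  by (rule fun_space.linear_endoI) (auto simp: var_action_def)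

lemma var_action_commute: "var_action i (var_action j l) = var_action j (var_action i l)"
  by (simp add: var_action_def mult.left_commute)

text \<open>The link between operators and ideals: a form over the ground field acts as the
  transpose of multiplication by an actual polynomial, while a general form over the closure is
  present only as an operator.\<close>

lemma form_action_rational:
  fixes a :: "'n::finite \<Rightarrow> 'a::field"
  assumes "l \<in> quot_dual J"
  shows "form_action (\<lambda>i. to_ac (a i)) l f = l (linear_poly a * f)"
proof -
  have "l 0 = 0" using assms by (auto simp: quot_dual_def) (metis add_cancel_right_right)
  hence sum: "l (\<Sum>i\<in>A. h i) = (\<Sum>i\<in>A. l (h i))" for A :: "'n set" and h
    using assms by (induction A rule: infinite_finite_induct) (auto simp: quot_dual_def)
  have "l (linear_poly a * f) = (\<Sum>i\<in>UNIV. l (mpoly_const (a i) * (mpoly_var i * f)))"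
    unfolding linear_poly_def sum_distrib_right sum by (simp add: mult.assoc)
  also have "\<dots> = (\<Sum>i\<in>UNIV. to_ac (a i) * l (mpoly_var i * f))"
    using assms by (auto simp: quot_dual_def)
  also have "\<dots> = form_action (\<lambda>i. to_ac (a i)) l f"
    by (simp add: fun_space.form_def sum_fun_apply var_action_def)
  finally show ?thesis ..
qed

lemma var_action_quot_dual:
  assumes "ideal J (mpoly_ring :: ('n, 'a::field) mpoly ring)" "l \<in> quot_dual J"
  shows "var_action i l \<in> quot_dual J"
  using assms by (auto simp: quot_dual_def var_action_def ideal_mpoly_iff distrib_left mult.left_commute)

text \<open>A functional killed by all variables vanishes on every monomial except 1, so it is a
  multiple of the constant coefficient. This starts the induction behind the section bound.\<close>

lemma socle_quot_dual:
  fixes J :: "('n::finite, 'a::field) mpoly set"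
  shows "fun_space.dim {l \<in> quot_dual J. \<forall>i\<in>UNIV. var_action i l = 0} \<le> 1"
proof -
  define e :: "('n, 'a) mpoly \<Rightarrow> 'a alg_closure" where "e f = to_ac (Poly_Mapping.lookup f 0)" for f
  have "l \<in> fun_space.span {e}" if l: "l \<in> quot_dual J" and z: "\<And>i. var_action i l = 0" for l
  proof -
    have l0: "l 0 = 0" using l by (auto simp: quot_dual_def) (metis add_cancel_right_right)
    have "l f = l 1 * e f" for f
    proof (induction f rule: mpoly_additive_induct)
      case zero show ?case using l0 by (simp add: e_def)
    next
      case (add f g)
      have "l (f + g) = l f + l g" using l unfolding quot_dual_def by blast
      thus ?case using add by (simp add: e_def lookup_add distrib_left)
    next
      case (single t c)
      show ?case
      proof (cases "t = 0")
        case True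
        have "l (mpoly_const c * 1) = to_ac c * l 1" using l unfolding quot_dual_def by blast
        thus ?thesis using True by (simp add: e_def mpoly_const_def)
      next
        case False
        then obtain i where i: "Poly_Mapping.lookup t i \<noteq> 0"
          by (metis lookup_zero poly_mapping_eqI)
        have "Poly_Mapping.single i 1 + (t - Poly_Mapping.single i 1) = t"
          by (rule poly_mapping_eqI) (use i in \<open>auto simp: lookup_add lookup_minus lookup_single when_def\<close>)
        hence "Poly_Mapping.single t c = mpoly_var i * Poly_Mapping.single (t - Poly_Mapping.single i 1) c"
          by (simp add: mpoly_var_def mult_single)
        hence "l (Poly_Mapping.single t c) = 0"
          using z[of i] by (simp add: var_action_def fun_eq_iff)
        thus ?thesis using False by (simp add: e_def lookup_single when_def)
      qed
    qed
    hence "l = (\<lambda>f. l 1 * e f)" by blast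
    thus ?thesis unfolding fun_space.span_singleton by blast
  qed
  hence "{l \<in> quot_dual J. \<forall>i\<in>UNIV. var_action i l = 0} \<subseteq> fun_space.span {e}" by blast
  from fun_space.dim_le_card[OF this] show ?thesis by simp
qed

section \<open>The bound\<close>

theorem theorem8p1:
  fixes I :: "('n::finite, 'a::{field,finite}) mpoly set"
    and q n m :: nat
  assumes "CARD('a) = q"
    and "CARD('n) = n" and "n \<ge> 2"
    and "quot_finite_dim I"
    and "hom_furstenberg (n - 1) m I"
    and "real m \<ge> ((exp 1)\<^sup>2 * real n) ^ n"
  shows "real (quot_dim I) \<ge>
    furstenberg_factor n m q * real m powr (real n / (real n - 1))"
proof -
  have I: "ideal I mpoly_ring"
    using assms(5) by (simp add: hom_furstenberg_def homogeneous_ideal_def)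
  define W where "W = quot_dual I"
  define N where "N = quot_dim I"
  have W: "fun_space.fin_dim W" and dimW: "fun_space.dim W = N"
    unfolding W_def N_def by (rule quot_dual_dim[OF I assms(4)])+
  have W_sub: "fun_space.fin_dim {l \<in> W. form_action t l = 0}" for t
  proof (rule fun_space.fin_dim_subset[OF W])
    interpret E: lin_space_pair "\<lambda>(c :: 'a alg_closure) (f :: ('n, 'a) mpoly \<Rightarrow> 'a alg_closure) x. c * f x"
      "\<lambda>(c :: 'a alg_closure) (f :: ('n, 'a) mpoly \<Rightarrow> 'a alg_closure) x. c * f x" by unfold_locales
    have "{l \<in> W. form_action t l = 0} = W \<inter> {l. form_action t l = 0}" by auto
    thus "fun_space.subspace {l \<in> W. form_action t l = 0}"
      using fun_space.subspace_inter[OF fun_space.fin_dim_subspace[OF W]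
          E.linear_subspace_kernel[OF fun_space.linear_form[of var_action, OF linear_var_action]]]
      by simp
  qed auto
  \<comment> \<open>A nonzero rational form cuts out a hyperplane \<open>V\<close> and lies in its
    vanishing ideal. Functionals that kill \<open>I\<close> and this ideal therefore lie in the
    kernel of the form on \<open>W\<close>.\<close>
  have rational: "m \<le> fun_space.dim {l \<in> W. form_action (\<lambda>i. to_ac (a i)) l = 0}"
    if "a i0 \<noteq> 0" for a :: "'n \<Rightarrow> 'a" and i0
  proof -
    define V :: "('a ^ 'n) set" where "V = {v. (\<Sum>i\<in>UNIV. a i * v $ i) = 0}"
    define J where "J = I <+>\<^bsub>mpoly_ring\<^esub> vanishing_ideal V"
    have J: "ideal J mpoly_ring"
      unfolding J_def by (rule ring.add_ideals[OF ring_mpoly_ring I ideal_vanishing_ideal])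
    have J_eq: "J = {f + g | f g. f \<in> I \<and> g \<in> vanishing_ideal V}"
      by (auto simp: J_def set_add_def')
    have "0 \<in> I" "0 \<in> vanishing_ideal V"
      using I ideal_vanishing_ideal[of V] by (auto simp: ideal_mpoly_iff)
    hence IJ: "I \<subseteq> J" and VJ: "vanishing_ideal V \<subseteq> J"
      unfolding J_eq by (auto, metis add.right_neutral, metis add.left_neutral)
    have fJ: "quot_finite_dim J" by (rule quot_finite_dim_mono[OF I J IJ assms(4)])
    have "m \<le> quot_dim J"
      using assms(2,5) dim_hyperplane[of a i0, OF that]
      by (auto simp: hom_furstenberg_def J_def V_def)
    also have "\<dots> = fun_space.dim (quot_dual J)" by (rule quot_dual_dim(2)[OF J fJ, symmetric])
    also have "\<dots> \<le> fun_space.dim {l \<in> W. form_action (\<lambda>i. to_ac (a i)) l = 0}"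
    proof (rule fun_space.dim_le[OF W_sub], safe)
      fix l assume l: "l \<in> quot_dual J"
      thus "l \<in> W" using IJ by (auto simp: quot_dual_def W_def)
      show "form_action (\<lambda>i. to_ac (a i)) l = 0"
      proof
        fix f
        have "linear_poly a \<in> J" using linear_poly_in_vanishing_ideal[of a] VJ by (auto simp: V_def)
        hence "f * linear_poly a \<in> J" using J unfolding ideal_mpoly_iff by blast
        hence "l (linear_poly a * f) = 0" using l by (auto simp: quot_dual_def mult.commute)
        thus "form_action (\<lambda>i. to_ac (a i)) l f = 0 f" using form_action_rational[OF l, of a f] by simp
      qed
    qed
    finally show ?thesis .
  qed
  have inf: "infinite (UNIV :: 'a alg_closure set)" by (rule infinite_alg_closed_field)
  have cardF: "card (range (to_ac :: 'a \<Rightarrow> _)) = q"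
    using assms(1) card_image[OF inj_to_ac] by metis
  obtain xs :: "'n list" where xs: "set xs = UNIV" "distinct xs"
    using finite_distinct_list[of "UNIV :: 'n set"] by auto
  have grid: "m \<le> fun_space.dim {l \<in> W. form_action a l = 0}"
    if "\<And>i. a i \<in> range (to_ac :: 'a \<Rightarrow> _)" for a
  proof -
    from that have "\<forall>i. \<exists>c. a i = to_ac c" by blast
    from choice[OF this] obtain b where b: "\<And>i. a i = to_ac (b i)" by blast
    hence a: "a = (\<lambda>i. to_ac (b i))" by blast
    show ?thesis
    proof (cases "\<exists>i. b i \<noteq> 0")
      case True
      thus ?thesis using rational a by blast
    next
      case False
      \<comment> \<open>The origin of the grid defines no hyperplane. There the kernel is all of
        \<open>W\<close>, which contains the kernel of the form with all coefficients 1.\<close>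
      have "m \<le> fun_space.dim {l \<in> W. form_action (\<lambda>i. to_ac (1 :: 'a)) l = 0}"
        using rational[of "\<lambda>_. 1"] by simp
      also have "\<dots> \<le> fun_space.dim W" by (rule fun_space.dim_le[OF W]) auto
      also have "W = {l \<in> W. form_action a l = 0}"
        using False by (auto simp: a fun_space.form_def fun_eq_iff sum_fun_apply)
      finally show ?thesis .
    qed
  qed
  \<comment> \<open>One form serves both estimates: as the form of maximal rank to which the grid is
    compared, and through its minimality as a lower bound for all sections.\<close>
  obtain t where t: "\<And>t'. fun_space.dim {l \<in> W. form_action t l = 0}
      \<le> fun_space.dim {l \<in> W. form_action t' l = 0}"
    using ex_has_least_nat[of "\<lambda>_. True" undefined "\<lambda>t. fun_space.dim {l \<in> W. form_action t l = 0}"]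
    by blast
  define m' where "m' = fun_space.dim {l \<in> W. form_action t l = 0}"
  have "card (range (to_ac :: 'a \<Rightarrow> _)) * (m - m') \<le> N - m'"
    using fun_space.kernel_dim_on_grid[where T = var_action and F = "range (to_ac :: 'a \<Rightarrow> _)"
        and m = m and t = t, OF inf _ linear_var_action W xs(2)] grid
    by (simp add: xs(1) m'_def dimW)
  hence "q * (m - m') \<le> N" using cardF by simp
  hence "real q * real (m - m') \<le> real N" by (metis of_nat_le_iff of_nat_mult)
  moreover have q: "q > 0" using assms(1) zero_less_card_finite[where ?'a = 'a] by simp
  ultimately have "real (m - m') \<le> real N / real q"
    by (subst pos_le_divide_eq) (auto simp: mult.commute)
  \<comment> \<open>Truncation in \<open>m - m'\<close> can only enlarge the real
    difference.\<close>
  hence bound: "real m \<le> real m' + real N / real q" by linarith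
  have "real m' \<le> (exp 1 * real (fun_space.dim W)) powr (real (n - 1) / real (Suc (n - 1)))"
  proof (rule fun_space.generic_section_bound[where T = var_action and B = UNIV, OF inf])
    show "card (UNIV :: 'n set) = Suc (n - 1)" using assms(2,3) by simp
    show "fun_space.dim {l \<in> W. \<forall>i\<in>UNIV. var_action i l = 0} \<le> 1"
      unfolding W_def by (rule socle_quot_dual)
    show "var_action i l \<in> W" if "l \<in> W" for i l
      using var_action_quot_dual[OF I] that by (simp add: W_def)
    show "m' \<le> fun_space.dim {l \<in> W. form_action t' l = 0}" for t'
      using t by (simp add: m'_def)
  qed (use W in \<open>auto intro: linear_var_action var_action_commute\<close>)
  also have "real (n - 1) / real (Suc (n - 1)) = (real n - 1) / real n" using assms(3) by (simp add: of_nat_diff)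
  finally have "real m \<le> (exp 1 * real N) powr ((real n - 1) / real n) + real N / real q"
    using bound dimW by simp
  moreover have "real m > 0"
  proof -
    have "0 < ((exp 1)\<^sup>2 * real n) ^ n" using assms(3) by simp
    thus ?thesis using assms(6) by linarith
  qed
  ultimately show ?thesis
    using furstenberg_numeric[OF assms(3) q, of "real m" "real N"]
    by (simp add: furstenberg_factor_def N_def)
qed

end
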